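(* Let $q$ be a power of an odd prime. The mixing time of the commuting chain on $GL(2,q)$ satisfies \[\frac{q+1}{4}\le t_{mix}\le\left\lceil (q+1)\log(16)+2\right\rceil .\] Furthermore, the sequence of commuting chains on $GL(2,q)$ (as $q\to\infty$ through the powers of odd primes) does not exhibit cutoff.
   Context: $GL(2,q)$ is the group of invertible $2\times2$ matrices over the field with $q$ elements. For a finite group $G$ and $x\in G$, let $C_x=\{h\in G: hx=xh\}$ and let $x^G$ be the conjugacy class of $x$. The commuting chain on $G$ is the Markov chain with state space $G$ and transition matrix $P(x,y)=\frac{1}{|C_x|}\mathbf 1_{\{xy=yx\}}$; its stationary distribution is $\pi(x)=\frac{1}{k|x^G|}$, where $k$ is the number of conjugacy classes of $G$. Total variation distance: $\Vert\mu-\nu\Vert_{TV}=\sup_{A}|\mu(A)-\nu(A)|$. Put $d(t)=\max_x\Vert P^t(x,\cdot)-\pi\Vert_{TV}$, $t_{mix}(\varepsilon)=\min\{t: d(t)\le\varepsilon\}$, and $t_{mix}=t_{mix}(1/4)$. A sequence of chains indexed by a parameter $n\to\infty$ with mixing times $t^{(n)}_{mix}(\varepsilon)$ exhibits cutoff if $\lim_{n\to\infty} t^{(n)}_{mix}(\varepsilon)/t^{(n)}_{mix}(1-\varepsilon)=1$ for all $\varepsilon\in(0,1)$. $\log$ is the natural logarithm. *)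

theory Defs
  imports
    Complex_Main
    "HOL-Computational_Algebra.Primes"
    "HOL-Algebra.Ring"
    "Jordan_Normal_Form.Matrix"
begin

definition odd_prime_power :: "nat \<Rightarrow> bool" where
  "odd_prime_power q \<longleftrightarrow> (\<exists>p k. prime p \<and> odd p \<and> 0 < k \<and> q = p ^ k)"

text \<open>
  The type of matrices is used here only as a container: the ring operations are those of the
  HOL-Algebra ring \<open>R\<close>, since the field has to vary with \<open>q\<close> and so cannot be a type.
\<close>

definition mat_monoid :: "nat \<Rightarrow> ('a, 'm) ring_scheme \<Rightarrow> 'a mat monoid" where
  "mat_monoid n R =
    \<lparr>carrier = {A \<in> carrier_mat n n. \<forall>i<n. \<forall>j<n. A $$ (i, j) \<in> carrier R},
     monoid.mult = (\<lambda>A B. mat n n (\<lambda>(i, j).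
       \<Oplus>\<^bsub>R\<^esub>k\<in>{..<n}. A $$ (i, k) \<otimes>\<^bsub>R\<^esub> B $$ (k, j))),
     one = mat n n (\<lambda>(i, j). if i = j then \<one>\<^bsub>R\<^esub> else \<zero>\<^bsub>R\<^esub>)\<rparr>"

definition GL :: "nat \<Rightarrow> ('a, 'm) ring_scheme \<Rightarrow> 'a mat monoid" where
  "GL n R = units_of (mat_monoid n R)"

definition centralizer :: "('a, 'm) monoid_scheme \<Rightarrow> 'a \<Rightarrow> 'a set" where
  "centralizer G x = {h \<in> carrier G. h \<otimes>\<^bsub>G\<^esub> x = x \<otimes>\<^bsub>G\<^esub> h}"

definition conj_class :: "('a, 'm) monoid_scheme \<Rightarrow> 'a \<Rightarrow> 'a set" where
  "conj_class G x = {g \<otimes>\<^bsub>G\<^esub> x \<otimes>\<^bsub>G\<^esub> inv\<^bsub>G\<^esub> g | g. g \<in> carrier G}"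

definition num_conj_classes :: "('a, 'm) monoid_scheme \<Rightarrow> nat" where
  "num_conj_classes G = card (conj_class G ` carrier G)"

text \<open>
  Markov chains on a finite state space \<open>S\<close>, given by a transition matrix \<open>P\<close>; distributions on
  \<open>S\<close> are given by their mass functions.
\<close>

primrec trans_power :: "'a set \<Rightarrow> ('a \<Rightarrow> 'a \<Rightarrow> real) \<Rightarrow> nat \<Rightarrow> 'a \<Rightarrow> 'a \<Rightarrow> real" where
  "trans_power S P 0 x y = (if x = y then 1 else 0)"
| "trans_power S P (Suc t) x y = (\<Sum>z\<in>S. trans_power S P t x z * P z y)"

definition tv_dist :: "'a set \<Rightarrow> ('a \<Rightarrow> real) \<Rightarrow> ('a \<Rightarrow> real) \<Rightarrow> real" where
  "tv_dist S \<mu> \<nu> = (SUP A\<in>Pow S. \<bar>sum \<mu> A - sum \<nu> A\<bar>)"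

definition worst_tv_dist ::
  "'a set \<Rightarrow> ('a \<Rightarrow> 'a \<Rightarrow> real) \<Rightarrow> ('a \<Rightarrow> real) \<Rightarrow> nat \<Rightarrow> real" where
  "worst_tv_dist S P \<pi> t = Max ((\<lambda>x. tv_dist S (trans_power S P t x) \<pi>) ` S)"

definition mixing_time ::
  "'a set \<Rightarrow> ('a \<Rightarrow> 'a \<Rightarrow> real) \<Rightarrow> ('a \<Rightarrow> real) \<Rightarrow> real \<Rightarrow> nat" where
  "mixing_time S P \<pi> \<epsilon> = (LEAST t. worst_tv_dist S P \<pi> t \<le> \<epsilon>)"

definition commuting_chain :: "('a, 'm) monoid_scheme \<Rightarrow> 'a \<Rightarrow> 'a \<Rightarrow> real" where
  "commuting_chain G x y =
    (if x \<otimes>\<^bsub>G\<^esub> y = y \<otimes>\<^bsub>G\<^esub> x then 1 / real (card (centralizer G x)) else 0)"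

definition commuting_stationary :: "('a, 'm) monoid_scheme \<Rightarrow> 'a \<Rightarrow> real" where
  "commuting_stationary G x = 1 / (real (num_conj_classes G) * real (card (conj_class G x)))"

definition commuting_tmix :: "('a, 'm) monoid_scheme \<Rightarrow> real \<Rightarrow> nat" where
  "commuting_tmix G \<epsilon> =
    mixing_time (carrier G) (commuting_chain G) (commuting_stationary G) \<epsilon>"

text \<open>
  Cutoff for a sequence of chains with mixing times \<open>tm n \<epsilon>\<close>, where \<open>n\<close> tends to infinity through
  the (infinite) index set \<open>I\<close>.
\<close>

definition exhibits_cutoff :: "nat set \<Rightarrow> (nat \<Rightarrow> real \<Rightarrow> nat) \<Rightarrow> bool" where
  "exhibits_cutoff I tm \<longleftrightarrow>
    (\<forall>\<epsilon>\<in>{0<..<1}.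
      ((\<lambda>n. real (tm n \<epsilon>) / real (tm n (1 - \<epsilon>))) \<longlongrightarrow> 1) (inf at_top (principal I)))"

end

theory Submission
  imports
    Defs
    "HOL-Library.Indicator_Function"
    "HOL-Algebra.Group_Action"
    "HOL-Algebra.Multiplicative_Group"
begin

text \<open>
  In \<open>GL 2 R\<close> two noncentral matrices that commute have the same centralizer, so the chain started
  at a noncentral \<open>x\<close> stays in \<open>centralizer G x\<close> until it hits the center, which happens with
  probability \<open>p x = card center / card (centralizer G x)\<close> at every step; here
  \<open>1 / (q + 1) \<le> p x \<le> 1 / (q - 1)\<close>.

  Upper bound: for two noncentral starting points the smaller of the two hitting probabilities can
  be coupled, and the two hitting probabilities differ only by \<open>O(1 / q\<^sup>2)\<close>; hence the transition
  operator contracts differences of functions at a rate close to \<open>1 - 1 / (q + 1)\<close>.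

  Lower bound: if the characteristic polynomial of \<open>x\<close> is irreducible then \<open>p x = 1 / (q + 1)\<close>, so the
  chain is still in \<open>centralizer G x - center\<close> at time \<open>t\<close> with probability at least
  \<open>1 - t / (q + 1)\<close>, whereas this set has stationary mass at most \<open>1 / 2\<close> because it is disjoint from
  one of its conjugates.

  No cutoff: both bounds live on the scale \<open>q + 1\<close>, and they separate the mixing times for
  \<open>\<epsilon> = 1 / 10\<close> and \<open>\<epsilon> = 9 / 10\<close> by a constant factor.
\<close>

section \<open>Finite Markov chains\<close>

text \<open>The power \<open>P^t\<close> acting on functions: the expectation of \<open>f\<close>
  after \<open>t\<close> steps from \<open>x\<close>. For the commuting chain this turns every step
  into an average over a centralizer.\<close>

definition markov_op :: "'a set \<Rightarrow> ('a \<Rightarrow> 'a \<Rightarrow> real) \<Rightarrow> nat \<Rightarrow> ('a \<Rightarrow> real) \<Rightarrow> 'a \<Rightarrow> real" where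
  "markov_op S P t f x = (\<Sum>y\<in>S. trans_power S P t x y * f y)"

lemma markov_op_0:
  assumes "finite S" "x \<in> S"
  shows "markov_op S P 0 f x = f x"
proof -
  have "markov_op S P 0 f x = (\<Sum>y\<in>S. if x = y then f y else 0)"
    unfolding markov_op_def by (intro sum.cong) auto
  then show ?thesis using assms by simp
qed

lemma markov_op_Suc_right:
  "markov_op S P (Suc t) f x = markov_op S P t (\<lambda>z. \<Sum>y\<in>S. P z y * f y) x"
proof -
  have "markov_op S P (Suc t) f x = (\<Sum>y\<in>S. \<Sum>z\<in>S. trans_power S P t x z * P z y * f y)"
    by (simp add: markov_op_def sum_distrib_right)
  also have "\<dots> = (\<Sum>z\<in>S. \<Sum>y\<in>S. trans_power S P t x z * P z y * f y)"
    by (rule sum.swap)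
  finally show ?thesis by (simp add: markov_op_def sum_distrib_left mult.assoc)
qed

text \<open>\<open>trans_power\<close> appends the new step at the end of the path. Moving it to the
  front allows conditioning on the first step, whose law is explicit in terms of the starting
  point.\<close>

lemma markov_op_Suc:
  assumes "finite S" "x \<in> S"
  shows "markov_op S P (Suc t) f x = (\<Sum>z\<in>S. P x z * markov_op S P t f z)"
proof (induction t arbitrary: f)
  case 0
  have "markov_op S P (Suc 0) f x = (\<Sum>y\<in>S. P x y * f y)"
    by (simp only: markov_op_Suc_right markov_op_0[OF assms])
  also have "\<dots> = (\<Sum>z\<in>S. P x z * markov_op S P 0 f z)"
    using assms by (intro sum.cong) (auto simp: markov_op_0)
  finally show ?case .
next
  case (Suc t)
  show ?case
    by (subst markov_op_Suc_right, subst Suc.IH) (simp only: markov_op_Suc_right)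
qed

lemma sum_trans_power_eq_markov_op:
  assumes "finite S" "A \<subseteq> S"
  shows "sum (trans_power S P t x) A = markov_op S P t (indicator A) x"
proof -
  have "(\<Sum>y\<in>S. trans_power S P t x y * indicator A y) =
      (\<Sum>y\<in>A. trans_power S P t x y * indicator A y)"
    using assms by (intro sum.mono_neutral_right) (auto simp: indicator_def)
  then show ?thesis
    using assms(2) by (simp add: markov_op_def)
qed

lemma tv_dist_le:
  assumes "\<And>A. A \<subseteq> S \<Longrightarrow> \<bar>sum \<mu> A - sum \<nu> A\<bar> \<le> b"
  shows "tv_dist S \<mu> \<nu> \<le> b"
  unfolding tv_dist_def using assms by (intro cSUP_least) auto

lemma tv_dist_ge:
  assumes "finite S" "A \<subseteq> S"
  shows "\<bar>sum \<mu> A - sum \<nu> A\<bar> \<le> tv_dist S \<mu> \<nu>"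
  unfolding tv_dist_def using assms by (intro cSUP_upper bdd_above_finite) auto

lemma tv_dist_le_worst_tv_dist:
  assumes "finite S" "x \<in> S"
  shows "tv_dist S (trans_power S P t x) \<pi> \<le> worst_tv_dist S P \<pi> t"
  unfolding worst_tv_dist_def using assms by (intro Max_ge) auto

lemma worst_tv_dist_le:
  assumes "finite S" "S \<noteq> {}" "\<And>x. x \<in> S \<Longrightarrow> tv_dist S (trans_power S P t x) \<pi> \<le> b"
  shows "worst_tv_dist S P \<pi> t \<le> b"
  unfolding worst_tv_dist_def using assms by (subst Max_le_iff) auto

section \<open>Averages over finite sets\<close>

definition avg :: "'a set \<Rightarrow> ('a \<Rightarrow> real) \<Rightarrow> real" where
  "avg A f = sum f A / real (card A)"

lemma avg_dist_le:
  assumes "finite A" "A \<noteq> {}" "\<And>a. a \<in> A \<Longrightarrow> \<bar>f a - c\<bar> \<le> w"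
  shows "\<bar>avg A f - c\<bar> \<le> w"
proof -
  have pos: "real (card A) > 0" using assms by (simp add: card_gt_0_iff)
  have "avg A f - c = (\<Sum>a\<in>A. f a - c) / card A"
    using pos by (simp add: avg_def sum_subtractf diff_divide_distrib)
  moreover have "\<bar>\<Sum>a\<in>A. f a - c\<bar> \<le> card A * w"
    using sum_abs[of "\<lambda>a. f a - c" A] sum_bounded_above[of A "\<lambda>a. \<bar>f a - c\<bar>" w, OF assms(3)]
    by linarith
  ultimately show ?thesis using pos by (simp add: abs_divide pos_divide_le_eq mult.commute)
qed

lemma avg_diff_le:
  assumes "finite A" "A \<noteq> {}" "finite B" "B \<noteq> {}"
    and "\<And>a b. a \<in> A \<Longrightarrow> b \<in> B \<Longrightarrow> \<bar>f a - f b\<bar> \<le> w"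
  shows "\<bar>avg A f - avg B f\<bar> \<le> w"
proof (rule avg_dist_le[OF assms(1,2)])
  fix a assume "a \<in> A"
  then have "\<bar>avg B f - f a\<bar> \<le> w"
    using assms by (intro avg_dist_le) (simp_all add: abs_minus_commute[of _ "f a"])
  then show "\<bar>f a - avg B f\<bar> \<le> w" by (simp add: abs_minus_commute)
qed

lemma avg_split:
  assumes "finite A" "B \<subseteq> A" "B \<noteq> {}" "A - B \<noteq> {}"
  defines "p \<equiv> real (card B) / real (card A)"
  shows "avg A f = p * avg B f + (1 - p) * avg (A - B) f"
proof -
  have fB: "finite B" using assms finite_subset by blast
  have c: "real (card (A - B)) = real (card A) - real (card B)"
    using assms fB by (simp add: card_Diff_subset card_mono of_nat_diff)
  have p: "real (card A) > 0" "real (card B) > 0" "real (card (A - B)) > 0"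
    using assms fB by (auto simp: card_gt_0_iff)
  have "sum f A = sum f B + sum f (A - B)"
    using assms sum.subset_diff[of B A f] by simp
  moreover have "(1 - p) = real (card (A - B)) / real (card A)"
    using p by (simp add: c p_def field_simps)
  ultimately show ?thesis using p by (simp add: avg_def p_def add_divide_distrib)
qed

section \<open>The commuting chain on a finite group\<close>

locale finite_group = group +
  assumes finite_carrier [simp]: "finite (carrier G)"
begin

definition center :: "'a set" where
  "center = {z \<in> carrier G. centralizer G z = carrier G}"

lemma centralizer_subset: "centralizer G x \<subseteq> carrier G"
  by (auto simp: centralizer_def)

lemma finite_centralizer [simp]: "finite (centralizer G x)"
  by (rule finite_subset[OF centralizer_subset]) simp

lemma self_in_centralizer: "x \<in> carrier G \<Longrightarrow> x \<in> centralizer G x"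
  by (simp add: centralizer_def)

lemma card_centralizer_pos: "x \<in> carrier G \<Longrightarrow> card (centralizer G x) > 0"
  using self_in_centralizer by (auto simp: card_gt_0_iff)

lemma centralizer_sym:
  "x \<in> carrier G \<Longrightarrow> y \<in> centralizer G x \<Longrightarrow> x \<in> centralizer G y"
  by (auto simp: centralizer_def)

lemma finite_center [simp]: "finite center"
  by (rule finite_subset[of _ "carrier G"]) (auto simp: center_def)

lemma one_in_center: "\<one> \<in> center"
  by (auto simp: center_def centralizer_def)

lemma card_center_pos: "card center > 0"
  using one_in_center by (auto simp: card_gt_0_iff)

lemma center_subset_centralizer: "x \<in> carrier G \<Longrightarrow> center \<subseteq> centralizer G x"
  using centralizer_sym by (fastforce simp: center_def)

section \<open>Conjugacy classes and the stationary distribution\<close>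

lemma conj_class_subset: "x \<in> carrier G \<Longrightarrow> conj_class G x \<subseteq> carrier G"
  by (auto simp: conj_class_def)

text \<open>The restricted abstraction has exactly the shape of the action in
  \<open>action_by_conjugation\<close>, so orbit facts carry over to
  \<open>conj_class\<close>.\<close>

lemma orbit_conj: "x \<in> carrier G \<Longrightarrow>
    orbit G (\<lambda>g. \<lambda>h\<in>carrier G. g \<otimes> h \<otimes> inv g) x = conj_class G x"
  by (auto simp: orbit_def conj_class_def)

lemma card_conj_class_mult_centralizer:
  assumes "x \<in> carrier G"
  shows "card (conj_class G x) * card (centralizer G x) = card (carrier G)"
proof -
  have "stabilizer G (\<lambda>g. \<lambda>h\<in>carrier G. g \<otimes> h \<otimes> inv g) x = centralizer G x"
    using assms by (auto simp: stabilizer_def centralizer_def inv_solve_right')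
  with group_action.orbit_stabilizer_theorem[OF action_by_conjugation assms]
  show ?thesis using assms by (simp add: orbit_conj order_def)
qed

lemma conj_class_eq_iff:
  assumes "x \<in> carrier G" "y \<in> carrier G"
  shows "conj_class G y = conj_class G x \<longleftrightarrow> y \<in> conj_class G x"
proof
  assume "conj_class G y = conj_class G x"
  then show "y \<in> conj_class G x"
    using group_action.orbit_refl[OF action_by_conjugation assms(2)] assms orbit_conj by auto
next
  have tr: "conj_class G u \<subseteq> conj_class G v"
    if "u \<in> conj_class G v" "u \<in> carrier G" "v \<in> carrier G" for u v
  proof
    fix w assume "w \<in> conj_class G u"
    moreover then have "w \<in> carrier G" using that conj_class_subset by auto
    ultimately show "w \<in> conj_class G v"
      using group_action.orbit_trans[OF action_by_conjugation, of v u w] that orbit_conj by simp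
  qed
  assume y: "y \<in> conj_class G x"
  then have "x \<in> conj_class G y"
    using group_action.orbit_sym[OF action_by_conjugation, of x y] assms orbit_conj by simp
  with y tr assms show "conj_class G y = conj_class G x" by blast
qed

lemma card_conj_class_pos: "x \<in> carrier G \<Longrightarrow> card (conj_class G x) > 0"
  using conj_class_eq_iff[of x x] finite_subset[OF conj_class_subset] by (auto simp: card_gt_0_iff)

text \<open>Grouping by classes, every class contributes 1. This is the normalization that makes
  \<open>\<pi>\<close> a probability distribution.\<close>

lemma sum_inverse_card_conj_class:
  "(\<Sum>x\<in>carrier G. 1 / real (card (conj_class G x))) = real (num_conj_classes G)"
proof -
  have "(\<Sum>x\<in>carrier G. 1 / real (card (conj_class G x))) =
     (\<Sum>c\<in>conj_class G ` carrier G. \<Sum>x | x \<in> carrier G \<and> conj_class G x = c. 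
        1 / real (card (conj_class G x)))"
    by (rule sum.image_gen) simp
  also have "\<dots> = (\<Sum>c\<in>conj_class G ` carrier G. 1)"
  proof (rule sum.cong[OF refl])
    fix c assume "c \<in> conj_class G ` carrier G"
    then obtain y where y: "y \<in> carrier G" "c = conj_class G y" by auto
    have e: "{x. x \<in> carrier G \<and> conj_class G x = c} = c"
      using y conj_class_eq_iff conj_class_subset[OF y(1)] by auto
    have "(\<Sum>x | x \<in> carrier G \<and> conj_class G x = c. 1 / real (card (conj_class G x))) =
        (\<Sum>x | x \<in> carrier G \<and> conj_class G x = c. 1 / real (card c))"
      by (rule sum.cong) auto
    also have "\<dots> = 1"
      using card_conj_class_pos[OF y(1)] unfolding e by (simp add: y(2))
    finally show "(\<Sum>x | x \<in> carrier G \<and> conj_class G x = c. 1 / real (card (conj_class G x))) = 1" .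
  qed
  finally show ?thesis by (simp add: num_conj_classes_def)
qed

lemma num_conj_classes_pos: "num_conj_classes G > 0"
  unfolding num_conj_classes_def by (auto simp: card_gt_0_iff)

abbreviation \<pi> :: "'a \<Rightarrow> real" where "\<pi> \<equiv> commuting_stationary G"

lemma stationary_nonneg: "\<pi> x \<ge> 0"
  by (simp add: commuting_stationary_def)

lemma sum_stationary: "sum \<pi> (carrier G) = 1"
proof -
  have "sum \<pi> (carrier G) =
      (\<Sum>x\<in>carrier G. 1 / real (card (conj_class G x))) / num_conj_classes G"
    by (simp add: commuting_stationary_def sum_divide_distrib mult.commute)
  then show ?thesis using num_conj_classes_pos by (simp add: sum_inverse_card_conj_class)
qed

text \<open>Orbit-stabilizer makes the mass proportional to the order of the centralizer, which is
  the denominator of a step from \<open>x\<close>. In this form reversibility can be read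
  off.\<close>

lemma stationary_eq:
  assumes "x \<in> carrier G"
  shows "\<pi> x = card (centralizer G x) / (num_conj_classes G * card (carrier G))"
  using card_centralizer_pos[OF assms] card_conj_class_pos[OF assms] num_conj_classes_pos
  by (auto simp: commuting_stationary_def field_simps
      simp flip: card_conj_class_mult_centralizer[OF assms])

section \<open>The transition operator and the distance from stationarity\<close>

abbreviation K :: "nat \<Rightarrow> ('a \<Rightarrow> real) \<Rightarrow> 'a \<Rightarrow> real" where
  "K \<equiv> markov_op (carrier G) (commuting_chain G)"

lemma K_0: "x \<in> carrier G \<Longrightarrow> K 0 f x = f x"
  by (simp add: markov_op_0)

lemma sum_centralizer_eq_sum_if:
  assumes "x \<in> carrier G"
  shows "sum g (centralizer G x) = (\<Sum>y\<in>carrier G. if x \<otimes> y = y \<otimes> x then g y else 0)"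
  using assms unfolding centralizer_def
  by (subst sum.inter_filter[symmetric]) (auto intro!: sum.cong)

lemma K_Suc:
  assumes "x \<in> carrier G"
  shows "K (Suc t) f x = avg (centralizer G x) (K t f)"
  unfolding markov_op_Suc[OF finite_carrier assms] avg_def sum_centralizer_eq_sum_if[OF assms]
    sum_divide_distrib
  by (rule sum.cong) (auto simp: commuting_chain_def)

text \<open>Reversibility: the weight \<open>\<pi> y\<close> cancels the denominator of the average,
  leaving a constant times a sum over commuting pairs, and commuting is symmetric, so the two sums
  may be swapped.\<close>

lemma sum_stationary_K: "(\<Sum>y\<in>carrier G. \<pi> y * K t f y) = (\<Sum>y\<in>carrier G. \<pi> y * f y)"
proof (induction t)
  case 0
  show ?case by (rule sum.cong) (auto simp: K_0)
next
  case (Suc t)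
  define c where "c = 1 / (real (num_conj_classes G) * card (carrier G))"
  have \<pi>: "\<pi> y = c * card (centralizer G y)" if "y \<in> carrier G" for y
    using stationary_eq[OF that] by (simp add: c_def)
  have "(\<Sum>y\<in>carrier G. \<pi> y * K (Suc t) f y) = (\<Sum>y\<in>carrier G. c * sum (K t f) (centralizer G y))"
    using card_centralizer_pos by (intro sum.cong) (auto simp: \<pi> K_Suc avg_def)
  also have "\<dots> = c * (\<Sum>y\<in>carrier G. \<Sum>z\<in>carrier G. if y \<otimes> z = z \<otimes> y then K t f z else 0)"
    by (simp add: sum_distrib_left sum_centralizer_eq_sum_if)
  also have "\<dots> = c * (\<Sum>z\<in>carrier G. \<Sum>y\<in>carrier G. if z \<otimes> y = y \<otimes> z then K t f z else 0)"
    by (subst sum.swap) (simp add: eq_commute)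
  also have "\<dots> = (\<Sum>z\<in>carrier G. c * (\<Sum>y\<in>centralizer G z. K t f z))"
    unfolding sum_distrib_left[of c "\<lambda>z. sum (h z) (carrier G)" for h]
    by (rule sum.cong) (simp_all only: sum_centralizer_eq_sum_if)
  also have "\<dots> = (\<Sum>z\<in>carrier G. \<pi> z * K t f z)"
    by (intro sum.cong) (auto simp: \<pi>)
  finally show ?case using Suc.IH by simp
qed

lemma K_nonneg:
  assumes "\<And>y. y \<in> carrier G \<Longrightarrow> f y \<ge> 0" "x \<in> carrier G"
  shows "K t f x \<ge> 0"
  using assms(2)
proof (induction t arbitrary: x)
  case 0
  then show ?case using assms by (simp add: K_0)
next
  case (Suc t)
  have "sum (K t f) (centralizer G x) \<ge> 0"
    using Suc.IH centralizer_subset by (intro sum_nonneg) auto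
  then show ?case using Suc.prems by (simp add: K_Suc avg_def)
qed

abbreviation d :: "nat \<Rightarrow> real" where
  "d \<equiv> worst_tv_dist (carrier G) (commuting_chain G) \<pi>"

text \<open>By stationarity \<open>sum \<pi> A\<close> is the \<open>\<pi>\<close>-average of
  \<open>K t (indicator A)\<close>, so its distance from the value at \<open>x\<close> is at most
  the oscillation of that function.\<close>

lemma d_le:
  assumes "\<And>A x y. A \<subseteq> carrier G \<Longrightarrow> x \<in> carrier G \<Longrightarrow> y \<in> carrier G \<Longrightarrow>
      \<bar>K t (indicator A) x - K t (indicator A) y\<bar> \<le> b"
  shows "d t \<le> b"
proof (intro worst_tv_dist_le tv_dist_le)
  fix x A assume x: "x \<in> carrier G" and A: "A \<subseteq> carrier G"
  let ?F = "K t (indicator A)"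
  have "sum \<pi> A = (\<Sum>y\<in>carrier G. \<pi> y * ?F y)"
    unfolding sum_stationary_K using A
    by (subst sum.mono_neutral_right[where S = A]) auto
  moreover have "?F x = (\<Sum>y\<in>carrier G. \<pi> y * ?F x)"
    using sum_stationary by (simp flip: sum_distrib_right)
  ultimately have "?F x - sum \<pi> A = (\<Sum>y\<in>carrier G. \<pi> y * (?F x - ?F y))"
    by (simp add: sum_subtractf right_diff_distrib)
  also have "\<bar>\<dots>\<bar> \<le> (\<Sum>y\<in>carrier G. \<bar>\<pi> y * (?F x - ?F y)\<bar>)" by (rule sum_abs)
  also have "\<dots> \<le> (\<Sum>y\<in>carrier G. \<pi> y * b)"
    using assms[OF A x] stationary_nonneg
    by (intro sum_mono) (auto simp: abs_mult intro!: mult_left_mono)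
  also have "\<dots> = b" using sum_stationary by (simp flip: sum_distrib_right)
  finally show "\<bar>sum (trans_power (carrier G) (commuting_chain G) t x) A - sum \<pi> A\<bar> \<le> b"
    using A by (simp add: sum_trans_power_eq_markov_op)
qed auto

lemma d_ge:
  assumes "A \<subseteq> carrier G" "x \<in> carrier G"
  shows "K t (indicator A) x - sum \<pi> A \<le> d t"
proof -
  have "K t (indicator A) x - sum \<pi> A \<le>
      \<bar>sum (trans_power (carrier G) (commuting_chain G) t x) A - sum \<pi> A\<bar>"
    using assms by (simp add: sum_trans_power_eq_markov_op)
  also have "\<dots> \<le> tv_dist (carrier G) (trans_power (carrier G) (commuting_chain G) t x) \<pi>"
    using assms by (intro tv_dist_ge) auto
  also have "\<dots> \<le> d t" using assms by (intro tv_dist_le_worst_tv_dist) auto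
  finally show ?thesis .
qed

end

section \<open>Groups whose noncentral centralizers coincide or meet in the center\<close>

text \<open>Isolates the group theory behind the mixing bounds: noncentral centralizers are abelian
  and determined by any of their noncentral elements, and the center has index between
  \<open>q - 1\<close> and \<open>q + 1\<close> in each of them.\<close>

locale ca_group = finite_group +
  fixes q :: nat
  assumes q_ge_3: "q \<ge> 3"
    and centralizer_eq: "\<lbrakk>x \<in> carrier G - center; y \<in> centralizer G x - center\<rbrakk> \<Longrightarrow>
      centralizer G y = centralizer G x"
    and card_centralizer_ge: "x \<in> carrier G - center \<Longrightarrow>
      (q - 1) * card center \<le> card (centralizer G x)"
    and card_centralizer_le: "x \<in> carrier G - center \<Longrightarrow>
      card (centralizer G x) \<le> (q + 1) * card center"
    and noncentral_exists: "carrier G \<noteq> center"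
begin

section \<open>The probability of stepping into the center\<close>

definition p :: "'a \<Rightarrow> real" where
  "p x = card center / card (centralizer G x)"

lemma p_pos: "x \<in> carrier G \<Longrightarrow> p x > 0"
  using card_center_pos card_centralizer_pos by (auto simp: p_def)

lemma p_ge:
  assumes "x \<in> carrier G - center"
  shows "p x \<ge> 1 / (q + 1)"
proof -
  have "real (card (centralizer G x)) \<le> real ((q + 1) * card center)"
    using card_centralizer_le[OF assms] by (simp only: of_nat_le_iff)
  moreover have "card (centralizer G x) > 0" using assms card_centralizer_pos[of x] by auto
  ultimately show ?thesis by (simp add: p_def divide_simps algebra_simps)
qed

lemma p_le: 
  assumes "x \<in> carrier G - center" 
  shows "p x \<le> 1 / (q - 1)"
proof -
  have "real ((q - 1) * card center) \<le> real (card (centralizer G x))"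
    using card_centralizer_ge[OF assms] by (simp only: of_nat_le_iff)
  moreover have "card (centralizer G x) > 0" using assms card_centralizer_pos[of x] by auto
  ultimately show ?thesis using q_ge_3 by (simp add: p_def divide_simps of_nat_diff mult.commute)
qed

text \<open>A central element has the largest possible centralizer. This settles which of two states
  has the larger \<open>p\<close> when a central one is compared with a noncentral one.\<close>

lemma p_center_le:
  assumes "z \<in> center" "x \<in> carrier G"
  shows "p z \<le> p x"
proof -
  have "card (centralizer G x) \<le> card (centralizer G z)"
    using assms centralizer_subset by (auto simp: center_def intro!: card_mono)
  then show ?thesis
    using card_centralizer_pos[OF assms(2)] unfolding p_def by (intro divide_left_mono) auto
qed

lemma centralizer_minus_center_nonempty: 
  assumes "x \<in> carrier G"
  shows "centralizer G x - center \<noteq> {}"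
proof (cases "x \<in> center")
  case True
  then show ?thesis using noncentral_exists by (auto simp: center_def)
next
  case False
  then show ?thesis using self_in_centralizer[OF assms] by auto
qed

lemma K_Suc_split:
  assumes "x \<in> carrier G"
  shows "K (Suc t) f x =
    p x * avg center (K t f) + (1 - p x) * avg (centralizer G x - center) (K t f)"
  unfolding K_Suc[OF assms] p_def
  using assms one_in_center centralizer_minus_center_nonempty[OF assms]
  by (intro avg_split center_subset_centralizer) auto

text \<open>
  \<open>\<theta> ^ t\<close> and \<open>\<beta> * \<theta> ^ t\<close> will bound the oscillation after \<open>t\<close> steps between two noncentral states and
  between a central and a noncentral one. The constants satisfy both contraction inequalities below
  down to \<open>q = 3\<close>, and the rate \<open>4 / 7\<close> exceeds the \<open>1 / 2\<close> that is needed to reach \<open>1 / 4\<close> at time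
  \<open>(q + 1) * ln 16\<close>, which leaves room for the factor \<open>\<beta>\<close>.
\<close>

definition \<theta> :: real where "\<theta> = 1 - 4 / (7 * (q + 1))"
definition \<beta> :: real where "\<beta> = 1 + 8 / (5 * (q + 1))"

text \<open>The left side equals \<open>1 - p y + (p x - p y) * (\<beta> - 1)\<close>. Here
  \<open>p y\<close> gains at least \<open>1 / (q + 1)\<close>, and the last term costs at most
  \<open>3 / 7\<close> of that, leaving the \<open>4 / 7\<close> in \<open>\<theta>\<close>.\<close>

lemma contraction_noncentral:
  assumes "x \<in> carrier G - center" "y \<in> carrier G - center"
  shows "(p x - p y) * \<beta> + (1 - p x) \<le> \<theta>"
proof -
  define r where "r = real q"
  have r: "r \<ge> 3" using q_ge_3 by (simp add: r_def)
  have px: "p x \<le> 1 / (r - 1)" and py: "p y \<ge> 1 / (r + 1)"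
    using p_le[OF assms(1)] p_ge[OF assms(2)] q_ge_3
    by (simp_all add: r_def of_nat_diff add.commute)
  have "3 * 3 \<le> r * r" using r by (intro mult_mono) auto
  then have "1 / (r - 1) - 1 / (r + 1) \<le> 15 / 56"
    using r by (simp add: field_simps)
  with px py have "p x - p y \<le> 15 / 56" by linarith
  then have "(p x - p y) * (8 / (5 * (r + 1))) \<le> 15 / 56 * (8 / (5 * (r + 1)))"
    using r by (intro mult_right_mono) auto
  also have "\<dots> = 3 / 7 * (1 / (r + 1))" using r by (simp add: field_simps)
  finally have "(p x - p y) * (8 / (5 * (r + 1))) \<le> 3 / 7 * (1 / (r + 1))" .
  moreover have "\<theta> = 1 - 4 / 7 * (1 / (r + 1))" by (simp add: \<theta>_def r_def add.commute)
  moreover have "(p x - p y) * \<beta> + (1 - p x) = 1 - p y + (p x - p y) * (8 / (5 * (r + 1)))"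
    by (simp add: \<beta>_def r_def algebra_simps)
  ultimately show ?thesis using py by linarith
qed

text \<open>With \<open>u = 1 / (q + 1)\<close> the left side is at most
  \<open>1 + 4 / 5 * u\<close>, because \<open>p x \<le> 1 / 2\<close>. The right side is
  \<open>1 + 36 / 35 * u - 32 / 35 * u * u\<close>, which is no smaller because
  \<open>u \<le> 1 / 4\<close>.\<close>

lemma contraction_central:
  assumes "x \<in> carrier G - center"
  shows "p x * \<beta> + (1 - p x) \<le> \<theta> * \<beta>"
proof -
  define u where "u = 1 / (real q + 1)"
  have u: "0 \<le> u" "u \<le> 1 / 4" using q_ge_3 by (auto simp: u_def field_simps)
  have "1 / real (q - 1) \<le> 1 / 2" using q_ge_3 by (simp add: field_simps)
  with p_le[OF assms] have px: "p x \<le> 1 / 2" by (rule order_trans)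
  have "u * p x \<le> u * (1 / 2)" "u * u \<le> u * (1 / 4)"
    using u px by (intro mult_left_mono; simp)+
  then have "p x * (1 + 8 / 5 * u) + (1 - p x) \<le> (1 - 4 / 7 * u) * (1 + 8 / 5 * u)"
    using u by (simp add: algebra_simps)
  moreover have "\<theta> = 1 - 4 / 7 * u" "\<beta> = 1 + 8 / 5 * u"
    by (simp_all add: \<theta>_def \<beta>_def u_def add.commute)
  ultimately show ?thesis by (simp only:)
qed

lemma \<theta>_pos: "\<theta> > 0" and \<beta>_ge_1: "\<beta> \<ge> 1"
  using q_ge_3 by (simp_all add: \<theta>_def \<beta>_def field_simps)

text \<open>The coupling argument in terms of functions. Both bounds go through one induction, since
  after a step a coupled pair of noncentral states may have become a central and a noncentral one,
  and conversely.\<close>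

lemma K_diff_le:
  assumes "\<And>x. x \<in> carrier G \<Longrightarrow> 0 \<le> f x \<and> f x \<le> 1"
  shows "(\<forall>x\<in>carrier G - center. \<forall>y\<in>carrier G - center. \<bar>K t f x - K t f y\<bar> \<le> \<theta> ^ t) \<and>
    (\<forall>z\<in>center. \<forall>y\<in>carrier G - center. \<bar>K t f z - K t f y\<bar> \<le> \<beta> * \<theta> ^ t)"
proof (induction t)
  case 0
  have "\<bar>K 0 f x - K 0 f y\<bar> \<le> 1" if "x \<in> carrier G" "y \<in> carrier G" for x y
    using assms[OF that(1)] assms[OF that(2)] that by (auto simp: K_0 abs_le_iff)
  moreover have "center \<subseteq> carrier G" by (auto simp: center_def)
  ultimately show ?case using order_trans[OF _ \<beta>_ge_1] by (auto simp: subset_iff)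
next
  case (Suc t)
  define \<zeta> where "\<zeta> = avg center (K t f)"
  define \<eta> where "\<eta> x = avg (centralizer G x - center) (K t f)" for x
  have w: "\<theta> ^ t \<ge> 0" using \<theta>_pos by simp
  have \<eta>\<eta>: "\<bar>\<eta> x - \<eta> y\<bar> \<le> \<theta> ^ t" if "x \<in> carrier G" "y \<in> carrier G" for x y
    unfolding \<eta>_def using that Suc.IH centralizer_minus_center_nonempty centralizer_subset
    by (intro avg_diff_le) (auto dest!: subsetD[OF centralizer_subset])
  have \<zeta>\<eta>: "\<bar>\<zeta> - \<eta> y\<bar> \<le> \<beta> * \<theta> ^ t" if "y \<in> carrier G" for y
    unfolding \<eta>_def \<zeta>_def using that Suc.IH centralizer_minus_center_nonempty one_in_center
    by (intro avg_diff_le) (auto dest!: subsetD[OF centralizer_subset])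
  have step: "\<bar>K (Suc t) f x - K (Suc t) f y\<bar> \<le> ((p x - p y) * \<beta> + (1 - p x)) * \<theta> ^ t"
    if "x \<in> carrier G" "y \<in> carrier G" "p y \<le> p x" for x y
  proof -
    have "p x \<le> 1"
      using that(1) center_subset_centralizer[OF that(1)] card_centralizer_pos[OF that(1)]
      by (simp add: p_def divide_simps card_mono)
    \<comment> \<open>The two first steps share central mass \<open>p y\<close> and noncentral mass
      \<open>1 - p x\<close>. The shared central part cancels, and the remaining mass
      \<open>p x - p y\<close> pairs a central state with a noncentral one.\<close>
    have "K (Suc t) f x - K (Suc t) f y = (p x - p y) * (\<zeta> - \<eta> y) + (1 - p x) * (\<eta> x - \<eta> y)"
      using that by (simp add: K_Suc_split \<zeta>_def \<eta>_def algebra_simps)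
    also have "\<bar>\<dots>\<bar> \<le> (p x - p y) * \<bar>\<zeta> - \<eta> y\<bar> + (1 - p x) * \<bar>\<eta> x - \<eta> y\<bar>"
      using that \<open>p x \<le> 1\<close>
      by (intro order_trans[OF abs_triangle_ineq]) (simp add: abs_mult)
    also have "\<dots> \<le> (p x - p y) * (\<beta> * \<theta> ^ t) + (1 - p x) * \<theta> ^ t"
      using that \<open>p x \<le> 1\<close> \<eta>\<eta> \<zeta>\<eta> by (intro add_mono mult_left_mono) auto
    finally show ?thesis by (simp add: algebra_simps)
  qed
  have noncentral: "\<bar>K (Suc t) f x - K (Suc t) f y\<bar> \<le> \<theta> ^ Suc t"
    if "x \<in> carrier G - center" "y \<in> carrier G - center" "p y \<le> p x" for x y
    using order_trans[OF step mult_right_mono[OF contraction_noncentral w]] that by simp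
  have "\<bar>K (Suc t) f x - K (Suc t) f y\<bar> \<le> \<theta> ^ Suc t"
    if "x \<in> carrier G - center" "y \<in> carrier G - center" for x y
    using noncentral[of x y] noncentral[of y x] that abs_minus_commute[of "K (Suc t) f x"]
    by (cases "p y \<le> p x") auto
  moreover have "\<bar>K (Suc t) f z - K (Suc t) f y\<bar> \<le> \<beta> * \<theta> ^ Suc t"
    if "z \<in> center" "y \<in> carrier G - center" for z y
  proof -
    have z: "z \<in> carrier G" using that by (simp add: center_def)
    \<comment> \<open>The noncentral state has the larger \<open>p\<close>, so it takes the first
      place in \<open>step\<close>.\<close>
    have "\<bar>K (Suc t) f z - K (Suc t) f y\<bar> \<le> ((p y - p z) * \<beta> + (1 - p y)) * \<theta> ^ t"
      using step[of y z] z that p_center_le[of z y]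
      by (simp only: abs_minus_commute[of "K (Suc t) f z"]) simp
    also have "\<dots> \<le> (p y * \<beta> + (1 - p y)) * \<theta> ^ t"
      using w \<beta>_ge_1 p_pos[OF z] by (intro mult_right_mono) (auto simp: algebra_simps)
    also have "\<dots> \<le> (\<theta> * \<beta>) * \<theta> ^ t"
      using contraction_central[OF that(2)] w by (intro mult_right_mono) auto
    finally show ?thesis by (simp add: algebra_simps)
  qed
  ultimately show ?case by blast
qed

text \<open>Pairs with a noncentral member are covered by \<open>K_diff_le\<close>. Two central
  states both make a uniform first step on the whole group, so they agree from time 1 on.\<close>

theorem d_upper:
  assumes "t \<ge> 1"
  shows "d t \<le> \<beta> * \<theta> ^ t"
proof (rule d_le)
  fix A x y assume *: "A \<subseteq> carrier G" "x \<in> carrier G" "y \<in> carrier G"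
  let ?F = "K t (indicator A)"
  have nc: "\<bar>?F x - ?F y\<bar> \<le> \<theta> ^ t"
    if "x \<in> carrier G - center" "y \<in> carrier G - center" for x y
    using K_diff_le[of "indicator A" t] that by auto
  have c: "\<bar>?F z - ?F y\<bar> \<le> \<beta> * \<theta> ^ t"
    if "z \<in> center" "y \<in> carrier G - center" for z y
    using K_diff_le[of "indicator A" t] that by auto
  have w: "0 \<le> \<theta> ^ t" "\<theta> ^ t \<le> \<beta> * \<theta> ^ t"
    using \<theta>_pos \<beta>_ge_1 mult_right_mono[of 1 \<beta> "\<theta> ^ t"] by auto
  obtain s where s: "t = Suc s" using assms by (cases t) auto
  consider "x \<in> center" "y \<in> center" | "x \<in> center" "y \<notin> center"
    | "x \<notin> center" "y \<in> center" | "x \<notin> center" "y \<notin> center" by blast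
  then show "\<bar>?F x - ?F y\<bar> \<le> \<beta> * \<theta> ^ t"
  proof cases
    case 1
    then have "?F x = ?F y" using * by (simp add: s K_Suc center_def)
    then show ?thesis using w by simp
  next
    case 2 then show ?thesis using c * by auto
  next
    case 3 then show ?thesis using c[of y x] * abs_minus_commute[of "?F x"] by auto
  next
    case 4 then show ?thesis using nc[of x y] * w by auto
  qed
qed

text \<open>If the conjugate of \<open>a\<close> lay in \<open>centralizer G x\<close>, it would be
  noncentral and so have the same centralizer as \<open>x\<close>. It commutes with the conjugate of
  \<open>x\<close>, because \<open>a\<close> commutes with \<open>x\<close>; hence that conjugate
  would lie in \<open>centralizer G x\<close>.\<close>

lemma conj_centralizer_disjoint:
  assumes x: "x \<in> carrier G - center" and g: "g \<in> carrier G"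
    and nc: "g \<otimes> x \<otimes> inv g \<notin> centralizer G x" and a: "a \<in> centralizer G x - center"
  shows "g \<otimes> a \<otimes> inv g \<notin> centralizer G x"
proof
  assume b: "g \<otimes> a \<otimes> inv g \<in> centralizer G x"
  let ?b = "g \<otimes> a \<otimes> inv g"
  have ac: "a \<in> carrier G" "x \<in> carrier G" using a x centralizer_subset by auto
  have conj_mult: "g \<otimes> u \<otimes> inv g \<otimes> (g \<otimes> v \<otimes> inv g) = g \<otimes> (u \<otimes> v) \<otimes> inv g"
    if "u \<in> carrier G" "v \<in> carrier G" for u v
  proof -
    have "inv g \<otimes> (g \<otimes> (v \<otimes> inv g)) = v \<otimes> inv g"
      using that g by (simp flip: m_assoc)
    then show ?thesis using that g by (simp add: m_assoc)
  qed
  \<comment> \<open>A central \<open>?b\<close> commutes with \<open>g\<close>, so undoing the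
    conjugation gives \<open>a = ?b\<close>, although \<open>a\<close> is noncentral.\<close>
  have "?b \<notin> center"
  proof
    assume "?b \<in> center"
    then have "g \<in> centralizer G ?b" using g by (simp add: center_def)
    then have "?b \<otimes> g = g \<otimes> ?b" by (simp add: centralizer_def)
    then have "g \<otimes> a = g \<otimes> ?b" using g ac by (simp add: m_assoc)
    then have "a = ?b" using g ac by simp
    with \<open>?b \<in> center\<close> a show False by simp
  qed
  then have eq: "centralizer G ?b = centralizer G x"
    using centralizer_eq[OF x] b by simp
  have "x \<otimes> a = a \<otimes> x" using a by (simp add: centralizer_def)
  then have "g \<otimes> x \<otimes> inv g \<in> centralizer G ?b"
    using g ac conj_mult[of x a] conj_mult[of a x] by (simp add: centralizer_def)
  with eq nc show False by simp
qed

lemma stationary_conj: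
  assumes "g \<in> carrier G" "a \<in> carrier G"
  shows "\<pi> (g \<otimes> a \<otimes> inv g) = \<pi> a"
proof -
  have "conj_class G (g \<otimes> a \<otimes> inv g) = conj_class G a"
    using assms by (subst conj_class_eq_iff) (auto simp: conj_class_def)
  then show ?thesis by (simp add: commuting_stationary_def)
qed

lemma stationary_centralizer_le_half:
  assumes x: "x \<in> carrier G - center" and g: "g \<in> carrier G"
    and nc: "g \<otimes> x \<otimes> inv g \<notin> centralizer G x"
  shows "sum \<pi> (centralizer G x - center) \<le> 1 / 2"
proof -
  let ?A = "centralizer G x - center"
  let ?h = "\<lambda>a. g \<otimes> a \<otimes> inv g"
  have A: "?A \<subseteq> carrier G" using centralizer_subset by auto
  have B: "?h ` ?A \<subseteq> carrier G" using A g by auto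
  have "inj_on ?h ?A" using g by (auto intro!: inj_onI dest!: subsetD[OF centralizer_subset])
  then have "sum \<pi> (?h ` ?A) = sum \<pi> ?A"
    using A g by (subst sum.reindex) (auto intro!: sum.cong stationary_conj)
  moreover have "?A \<inter> ?h ` ?A = {}"
    using conj_centralizer_disjoint[OF assms] by auto
  then have "sum \<pi> (?A \<union> ?h ` ?A) = sum \<pi> ?A + sum \<pi> (?h ` ?A)"
    by (intro sum.union_disjoint) auto
  moreover have "sum \<pi> (?A \<union> ?h ` ?A) \<le> sum \<pi> (carrier G)"
    using A B stationary_nonneg by (intro sum_mono2) auto
  ultimately show ?thesis using sum_stationary by linarith
qed

text \<open>Survival probability: as long as the chain stays in the set, each step leaves it with
  the same probability \<open>p x\<close>, which is Bernoulli's inequality for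
  \<open>(1 - p x) ^ t\<close>.\<close>

lemma K_indicator_ge:
  assumes x: "x \<in> carrier G - center" and y: "y \<in> centralizer G x - center"
  shows "K t (indicator (centralizer G x - center)) y \<ge> 1 - t * p x"
  using y
proof (induction t arbitrary: y)
  case 0
  then show ?case using centralizer_subset by (subst K_0) auto
next
  case (Suc t)
  let ?F = "K t (indicator (centralizer G x - center))"
  have y: "y \<in> carrier G" using Suc.prems centralizer_subset by auto
  have eq: "centralizer G y = centralizer G x" by (rule centralizer_eq[OF x Suc.prems])
  have py: "p y = p x" by (simp add: p_def eq)
  have le1: "p x \<le> 1"
    using x center_subset_centralizer[of x] card_centralizer_pos[of x]
    by (simp add: p_def divide_simps card_mono)
  have "sum ?F center \<ge> 0"
    by (intro sum_nonneg K_nonneg) (auto simp: center_def)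
  then have \<zeta>: "avg center ?F \<ge> 0" by (simp add: avg_def)
  have card: "real (card (centralizer G x - center)) > 0"
    using Suc.prems by (auto simp: card_gt_0_iff)
  have "real (card (centralizer G x - center)) * (1 - t * p x) \<le> sum ?F (centralizer G x - center)"
    using Suc.IH by (intro sum_bounded_below) auto
  then have \<eta>: "1 - t * p x \<le> avg (centralizer G x - center) ?F"
    using card by (simp add: avg_def pos_le_divide_eq mult.commute)
  \<comment> \<open>The right side exceeds the left by the nonnegative term
    \<open>t * (p x)\<^sup>2\<close>.\<close>
  have "1 - Suc t * p x \<le> (1 - p x) * (1 - t * p x)"
    by (simp add: algebra_simps)
  also have "\<dots> \<le> (1 - p x) * avg (centralizer G x - center) ?F"
    using \<eta> le1 by (intro mult_left_mono) auto
  also have "\<dots> \<le> p x * avg center ?F + (1 - p x) * avg (centralizer G x - center) ?F"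
    using \<zeta> p_pos[of x] x by simp
  finally show ?case by (simp add: K_Suc_split[OF y] eq py)
qed

theorem d_lower:
  assumes x: "x \<in> carrier G - center" and g: "g \<in> carrier G"
    and nc: "g \<otimes> x \<otimes> inv g \<notin> centralizer G x"
    and card: "card (centralizer G x) = (q + 1) * card center"
  shows "1 / 2 - t / (q + 1) \<le> d t"
proof -
  have p: "p x = 1 / (q + 1)" using card card_center_pos one_in_center unfolding p_def card of_nat_mult by auto
  have "x \<in> centralizer G x - center" using x self_in_centralizer by auto
  have "K t (indicator (centralizer G x - center)) x - sum \<pi> (centralizer G x - center) \<le> d t"
    using x centralizer_subset by (intro d_ge) auto
  with K_indicator_ge[OF x \<open>x \<in> centralizer G x - center\<close>, of t] stationary_centralizer_le_half[OF x g nc]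
  show ?thesis by (simp add: p)
qed

end

section \<open>Bounds for the mixing times\<close>

context ca_group
begin

lemma commuting_tmix_eq: "commuting_tmix G \<epsilon> = (LEAST t. d t \<le> \<epsilon>)"
  by (simp add: commuting_tmix_def mixing_time_def)

lemma commuting_tmix_le: "d t \<le> \<epsilon> \<Longrightarrow> commuting_tmix G \<epsilon> \<le> t"
  unfolding commuting_tmix_eq by (rule Least_le)

text \<open>Guarantees that the \<open>LEAST\<close> in the mixing time is attained, so that the
  distance at that time is really at most \<open>\<epsilon>\<close>.\<close>

lemma d_eventually_le:
  assumes "\<epsilon> > 0"
  shows "\<exists>t. d t \<le> \<epsilon>"
proof -
  have "\<theta> < 1" by (simp add: \<theta>_def)
  then obtain n where n: "\<theta> ^ n < \<epsilon> / \<beta>"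
    using real_arch_pow_inv[of "\<epsilon> / \<beta>" \<theta>] assms \<beta>_ge_1 by auto
  \<comment> \<open>Passing to \<open>Suc n\<close> meets the condition \<open>t \<ge> 1\<close> of
    \<open>d_upper\<close>.\<close>
  have "\<theta> ^ Suc n \<le> \<theta> ^ n" using \<open>\<theta> < 1\<close> \<theta>_pos by (intro power_decreasing) auto
  with n have "\<theta> ^ Suc n \<le> \<epsilon> / \<beta>" by linarith
  then have "\<beta> * \<theta> ^ Suc n \<le> \<epsilon>" using \<beta>_ge_1 by (simp add: field_simps)
  then show ?thesis using d_upper[of "Suc n"] by (intro exI[of _ "Suc n"]) auto
qed

text \<open>The inequality \<open>1 + v \<le> exp v\<close> is applied to both
  \<open>\<beta>\<close> and \<open>\<theta>\<close>.\<close>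

lemma d_upper_exp:
  assumes "t \<ge> 1"
  shows "d t \<le> exp ((8 / 5 - 4 / 7 * t) / (q + 1))"
proof -
  have "\<theta> \<le> exp (- (4 / (7 * (q + 1))))" "\<beta> \<le> exp (8 / (5 * (q + 1)))"
    using exp_ge_add_one_self[of "- (4 / (7 * (real q + 1)))"]
      exp_ge_add_one_self[of "8 / (5 * (real q + 1))"]
    by (simp_all add: \<theta>_def \<beta>_def add.commute)
  then have "\<beta> * \<theta> ^ t \<le> exp (8 / (5 * (q + 1))) * exp (- (4 / (7 * (q + 1)))) ^ t"
    using \<beta>_ge_1 \<theta>_pos by (intro mult_mono power_mono) auto
  also have "\<dots> = exp (8 / (5 * (q + 1)) + t * - (4 / (7 * (q + 1))))"
    by (simp only: exp_add exp_of_nat_mult)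
  also have "8 / (5 * (q + 1)) + t * - (4 / (7 * (q + 1))) = (8 / 5 - 4 / 7 * t) / (real q + 1)"
    by (simp add: diff_divide_distrib add.commute)
  finally show ?thesis using d_upper[OF assms] by (simp add: add.commute)
qed

theorem commuting_tmix_quarter_le:
  "int (commuting_tmix G (1/4)) \<le> \<lceil>(real q + 1) * ln 16 + 2\<rceil>"
proof -
  define T where "T = nat \<lceil>(real q + 1) * ln 16 + 2\<rceil>"
  have "0 \<le> (real q + 1) * ln 16" by simp
  then have T: "int T = \<lceil>(real q + 1) * ln 16 + 2\<rceil>" "T \<ge> 1" unfolding T_def by linarith+
  have T': "(real q + 1) * ln 16 + 2 \<le> T" unfolding T_def by linarith
  have "exp 1 \<le> (4::real)" using exp_le by linarith
  then have ln4: "1 \<le> ln (4::real)" by (simp add: ln_ge_iff)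
  have ln16: "ln (16::real) = 2 * ln 4" using ln_realpow[of 4 2] by simp
  have "(8 / 5 - 4 / 7 * T) \<le> 8 / 5 - 4 / 7 * ((real q + 1) * (2 * ln 4) + 2)"
    using T' unfolding ln16 by simp
  also have "\<dots> = 16 / 35 - 8 / 7 * ((real q + 1) * ln 4)" by (simp add: algebra_simps)
  \<comment> \<open>The surplus \<open>1 / 7 * (q + 1) * ln 4\<close> is at least
    \<open>4 / 7\<close>, since \<open>q + 1 \<ge> 4\<close> and \<open>ln 4 \<ge> 1\<close>; it
    absorbs the \<open>16 / 35\<close>.\<close>
  also have "\<dots> \<le> - ln 4 * (real q + 1)"
    using mult_mono[of 4 "real q + 1" 1 "ln 4"] q_ge_3 ln4 by (simp add: algebra_simps)
  finally have "(8 / 5 - 4 / 7 * T) / (real q + 1) \<le> - ln 4" by (simp add: pos_divide_le_eq)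
  then have "exp ((8 / 5 - 4 / 7 * T) / (real q + 1)) \<le> exp (- ln 4)" by simp
  then have "d T \<le> 1 / 4" using d_upper_exp[OF T(2)] by (simp add: exp_minus add.commute)
  then show ?thesis using commuting_tmix_le[of T "1/4"] T by simp
qed

text \<open>At time about \<open>3 / 10 * (q + 1)\<close> the exponent is below
  \<open>- 1 / 9\<close>, and \<open>exp (1 / 9) \<ge> 10 / 9\<close>. For
  \<open>q \<ge> 100\<close> rounding up costs at most \<open>(q + 1) / 100\<close>.\<close>

lemma commuting_tmix_nine_tenths_le:
  assumes "q \<ge> 100"
  shows "commuting_tmix G (9/10) \<le> 31 / 100 * (real q + 1)"
proof -
  define T where "T = nat \<lceil>3 / 10 * (real q + 1)\<rceil>"
  have T: "3 / 10 * (real q + 1) \<le> T" "T \<le> 3 / 10 * (real q + 1) + 1"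
    unfolding T_def using of_int_ceiling_le_add_one[of "3 / 10 * (real q + 1)"] by (auto simp: of_nat_nat)
  have q: "real q \<ge> 100" using assms by simp
  have "real T \<ge> 1" using T(1) q by argo
  then have T1: "T \<ge> 1" by simp
  have "(8 / 5 - 4 / 7 * T) \<le> - (1 / 9) * (real q + 1)"
    using T(1) q by argo
  then have "(8 / 5 - 4 / 7 * T) / (real q + 1) \<le> - (1 / 9)" by (simp add: divide_simps)
  then have "exp ((8 / 5 - 4 / 7 * T) / (real q + 1)) \<le> exp (- (1 / 9))" by simp
  also have "\<dots> \<le> 9 / 10"
    using exp_ge_add_one_self[of "1 / 9 :: real"] by (simp add: exp_minus field_simps)
  finally have "d T \<le> 9 / 10" using d_upper_exp[OF T1] by (simp add: add.commute)
  from commuting_tmix_le[OF this] have "real (commuting_tmix G (9/10)) \<le> T" by simp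
  then show ?thesis using T(2) q by argo
qed

section \<open>Lower bounds from an element with a centralizer of maximal order\<close>

context
  fixes x g
  assumes x: "x \<in> carrier G - center" and g: "g \<in> carrier G"
    and nc: "g \<otimes> x \<otimes> inv g \<notin> centralizer G x"
    and card: "card (centralizer G x) = (q + 1) * card center"
begin

theorem commuting_tmix_ge:
  assumes "\<epsilon> > 0"
  shows "(1 / 2 - \<epsilon>) * (real q + 1) \<le> commuting_tmix G \<epsilon>"
proof -
  have "d (commuting_tmix G \<epsilon>) \<le> \<epsilon>"
    unfolding commuting_tmix_eq by (rule LeastI_ex[OF d_eventually_le[OF assms]])
  with d_lower[OF x g nc card, of "commuting_tmix G \<epsilon>"]
  have "1 / 2 - \<epsilon> \<le> commuting_tmix G \<epsilon> / (real q + 1)" by (simp add: add.commute)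
  then show ?thesis by (simp add: field_simps)
qed

text \<open>The lower bound \<open>2 / 5 * (q + 1)\<close> for \<open>\<epsilon> = 1 / 10\<close>
  exceeds the upper bound \<open>31 / 100 * (q + 1)\<close> for \<open>\<epsilon> = 9 / 10\<close>
  by more than the factor \<open>6 / 5\<close>.\<close>

theorem commuting_tmix_ratio:
  assumes "q \<ge> 100"
  shows "\<bar>real (commuting_tmix G (1/10)) / real (commuting_tmix G (9/10)) - 1\<bar> \<ge> 1 / 5"
proof (cases "commuting_tmix G (9/10) = 0")
  case False
  have "6 / 5 * real (commuting_tmix G (9/10)) \<le> real (commuting_tmix G (1/10))"
    using commuting_tmix_ge[of "1/10"] commuting_tmix_nine_tenths_le[OF assms] by simp
  then have "6 / 5 \<le> real (commuting_tmix G (1/10)) / real (commuting_tmix G (9/10))"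
    using False by (simp add: field_simps)
  then show ?thesis by linarith
\<comment> \<open>For a zero denominator the quotient is 0 by convention, at distance 1 from
  1.\<close>
qed simp

end
end

section \<open>The group of invertible two-by-two matrices\<close>

definition m2 :: "'a \<Rightarrow> 'a \<Rightarrow> 'a \<Rightarrow> 'a \<Rightarrow> 'a mat" where
  "m2 a b c d = mat 2 2 (\<lambda>(i, j). if i = 0 then if j = 0 then a else b else if j = 0 then c else d)"

lemma m2_index [simp]:
  "m2 a b c d $$ (0, 0) = a" "m2 a b c d $$ (0, Suc 0) = b"
  "m2 a b c d $$ (Suc 0, 0) = c" "m2 a b c d $$ (Suc 0, Suc 0) = d"
  by (simp_all add: m2_def)

lemma m2_carrier_mat [simp]: "m2 a b c d \<in> carrier_mat 2 2"
  by (simp add: m2_def)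

lemma m2_eq_iff [simp]:
  "m2 a b c d = m2 a' b' c' d' \<longleftrightarrow> a = a' \<and> b = b' \<and> c = c' \<and> d = d'"
  by (metis m2_index)

lemma less_2_iff: "i < (2::nat) \<longleftrightarrow> i = 0 \<or> i = Suc 0"
  by auto

lemma mat_2_eq_m2: "mat 2 2 f = m2 (f (0, 0)) (f (0, Suc 0)) (f (Suc 0, 0)) (f (Suc 0, Suc 0))"
  by (rule eq_matI) (auto simp: m2_def less_2_iff)

lemma carrier_mat_2_eq_m2:
  assumes "A \<in> carrier_mat 2 2"
  shows "A = m2 (A $$ (0, 0)) (A $$ (0, Suc 0)) (A $$ (Suc 0, 0)) (A $$ (Suc 0, Suc 0))"
  using assms by (intro eq_matI) (auto simp: m2_def less_2_iff)

section \<open>Coordinates, determinants and commuting pairs over a field\<close>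

context field
begin

definition det2 :: "'a \<Rightarrow> 'a \<Rightarrow> 'a \<Rightarrow> 'a \<Rightarrow> 'a" where
  "det2 a b c d = a \<otimes> d \<ominus> b \<otimes> c"

lemma det2_closed [simp]:
  "\<lbrakk>a \<in> carrier R; b \<in> carrier R; c \<in> carrier R; d \<in> carrier R\<rbrakk> \<Longrightarrow> det2 a b c d \<in> carrier R"
  by (simp add: det2_def)

lemma m2_in_mat_monoid [simp]:
  "m2 a b c d \<in> carrier (mat_monoid 2 R) \<longleftrightarrow>
    a \<in> carrier R \<and> b \<in> carrier R \<and> c \<in> carrier R \<and> d \<in> carrier R"
  by (auto simp: mat_monoid_def less_2_iff)

lemma mat_monoid_2_cases:
  assumes "A \<in> carrier (mat_monoid 2 R)"
  obtains a b c d where "A = m2 a b c d" "a \<in> carrier R" "b \<in> carrier R" "c \<in> carrier R" "d \<in> carrier R"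
proof -
  have "A \<in> carrier_mat 2 2" using assms by (simp add: mat_monoid_def)
  from carrier_mat_2_eq_m2[OF this] show ?thesis
    using that assms by (auto simp: mat_monoid_def)
qed

lemma m2_mult [simp]:
  assumes "a \<in> carrier R" "b \<in> carrier R" "c \<in> carrier R" "d \<in> carrier R"
    "e \<in> carrier R" "f \<in> carrier R" "g \<in> carrier R" "h \<in> carrier R"
  shows "m2 a b c d \<otimes>\<^bsub>mat_monoid 2 R\<^esub> m2 e f g h =
    m2 (a \<otimes> e \<oplus> b \<otimes> g) (a \<otimes> f \<oplus> b \<otimes> h) (c \<otimes> e \<oplus> d \<otimes> g) (c \<otimes> f \<oplus> d \<otimes> h)"
proof -
  have "{..<2::nat} = {0, Suc 0}" by auto
  then show ?thesis using assms by (simp add: mat_monoid_def mat_2_eq_m2)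
qed

lemma m2_one: "\<one>\<^bsub>mat_monoid 2 R\<^esub> = m2 \<one> \<zero> \<zero> \<one>"
  by (simp add: mat_monoid_def mat_2_eq_m2)

lemma monoid_mat_monoid_2: "monoid (mat_monoid 2 R)"
proof (rule monoidI)
  fix x y z
  assume "x \<in> carrier (mat_monoid 2 R)" "y \<in> carrier (mat_monoid 2 R)" "z \<in> carrier (mat_monoid 2 R)"
  then show "x \<otimes>\<^bsub>mat_monoid 2 R\<^esub> y \<otimes>\<^bsub>mat_monoid 2 R\<^esub> z =
      x \<otimes>\<^bsub>mat_monoid 2 R\<^esub> (y \<otimes>\<^bsub>mat_monoid 2 R\<^esub> z)"
    by (elim mat_monoid_2_cases) (simp, intro conjI; algebra)
qed (auto elim!: mat_monoid_2_cases simp: m2_one)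

lemma det2_mult:
  assumes "a \<in> carrier R" "b \<in> carrier R" "c \<in> carrier R" "d \<in> carrier R"
    "e \<in> carrier R" "f \<in> carrier R" "g \<in> carrier R" "h \<in> carrier R"
  shows "det2 (a \<otimes> e \<oplus> b \<otimes> g) (a \<otimes> f \<oplus> b \<otimes> h) (c \<otimes> e \<oplus> d \<otimes> g) (c \<otimes> f \<oplus> d \<otimes> h) =
    det2 a b c d \<otimes> det2 e f g h"
  using assms unfolding det2_def by algebra

text \<open>A left inverse forces a nonzero determinant by multiplicativity; conversely the adjugate
  divided by the determinant is an inverse.\<close>

lemma m2_in_GL_iff:
  "m2 a b c d \<in> carrier (GL 2 R) \<longleftrightarrow>
    a \<in> carrier R \<and> b \<in> carrier R \<and> c \<in> carrier R \<and> d \<in> carrier R \<and> det2 a b c d \<noteq> \<zero>"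
    (is "?l \<longleftrightarrow> ?r")
proof
  assume ?l
  then have abcd: "a \<in> carrier R" "b \<in> carrier R" "c \<in> carrier R" "d \<in> carrier R" and
    "\<exists>y\<in>carrier (mat_monoid 2 R). y \<otimes>\<^bsub>mat_monoid 2 R\<^esub> m2 a b c d = \<one>\<^bsub>mat_monoid 2 R\<^esub>"
    by (auto simp: GL_def units_of_def Units_def)
  then obtain e f g h where efgh: "e \<in> carrier R" "f \<in> carrier R" "g \<in> carrier R" "h \<in> carrier R"
    and "m2 e f g h \<otimes>\<^bsub>mat_monoid 2 R\<^esub> m2 a b c d = m2 \<one> \<zero> \<zero> \<one>"
    unfolding m2_one by (elim bexE mat_monoid_2_cases) auto
  then have "det2 e f g h \<otimes> det2 a b c d = det2 \<one> \<zero> \<zero> \<one>"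
    using abcd by (simp flip: det2_mult)
  then have "det2 a b c d \<noteq> \<zero>" using efgh by (auto simp: det2_def a_minus_def)
  then show ?r using abcd by simp
next
  assume r: ?r
  define i where "i = inv det2 a b c d"
  have i: "i \<in> carrier R" "i \<otimes> (a \<otimes> d \<ominus> b \<otimes> c) = \<one>"
    using r field_Units unfolding i_def det2_def[symmetric] by auto
  let ?y = "m2 (i \<otimes> d) (\<ominus> (i \<otimes> b)) (\<ominus> (i \<otimes> c)) (i \<otimes> a)"
  have e: "a \<otimes> (i \<otimes> d) \<oplus> b \<otimes> \<ominus> (i \<otimes> c) = i \<otimes> (a \<otimes> d \<ominus> b \<otimes> c)"
    "c \<otimes> \<ominus> (i \<otimes> b) \<oplus> d \<otimes> (i \<otimes> a) = i \<otimes> (a \<otimes> d \<ominus> b \<otimes> c)"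
    "i \<otimes> d \<otimes> a \<oplus> \<ominus> (i \<otimes> b) \<otimes> c = i \<otimes> (a \<otimes> d \<ominus> b \<otimes> c)"
    "\<ominus> (i \<otimes> c) \<otimes> b \<oplus> i \<otimes> a \<otimes> d = i \<otimes> (a \<otimes> d \<ominus> b \<otimes> c)"
    "a \<otimes> \<ominus> (i \<otimes> b) \<oplus> b \<otimes> (i \<otimes> a) = \<zero>" "c \<otimes> (i \<otimes> d) \<oplus> d \<otimes> \<ominus> (i \<otimes> c) = \<zero>"
    "i \<otimes> d \<otimes> b \<oplus> \<ominus> (i \<otimes> b) \<otimes> d = \<zero>" "\<ominus> (i \<otimes> c) \<otimes> a \<oplus> i \<otimes> a \<otimes> c = \<zero>"
    using r i(1) by algebra+
  have "m2 a b c d \<otimes>\<^bsub>mat_monoid 2 R\<^esub> ?y = \<one>\<^bsub>mat_monoid 2 R\<^esub>"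
    "?y \<otimes>\<^bsub>mat_monoid 2 R\<^esub> m2 a b c d = \<one>\<^bsub>mat_monoid 2 R\<^esub>"
    using r i by (simp_all add: e m2_one)
  moreover have "?y \<in> carrier (mat_monoid 2 R)" using r i by simp
  ultimately show ?l using r unfolding GL_def units_of_def Units_def
    by (auto intro!: bexI[of _ ?y] simp del: m2_mult)
qed

lemma GL_2_cases:
  assumes "A \<in> carrier (GL 2 R)"
  obtains a b c d where "A = m2 a b c d" "a \<in> carrier R" "b \<in> carrier R" "c \<in> carrier R" "d \<in> carrier R"
    "det2 a b c d \<noteq> \<zero>"
proof -
  have "A \<in> carrier (mat_monoid 2 R)" using assms by (simp add: GL_def units_of_def Units_def)
  then show ?thesis using assms that by (elim mat_monoid_2_cases) (auto simp: m2_in_GL_iff)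
qed

lemma group_GL_2: "group (GL 2 R)"
  unfolding GL_def by (rule monoid.units_group[OF monoid_mat_monoid_2])

lemma mult_GL [simp]: "mult (GL 2 R) = mult (mat_monoid 2 R)"
  by (simp add: GL_def units_of_def)

text \<open>A vector whose cross product with a nonzero vector vanishes is a multiple of it; the
  factor is the quotient at a nonzero coordinate.\<close>

lemma cross_product_zero_imp_multiple:
  assumes c: "u \<in> carrier R" "v \<in> carrier R" "w \<in> carrier R" "x \<in> carrier R" "y \<in> carrier R" "z \<in> carrier R"
    and nz: "u \<noteq> \<zero> \<or> v \<noteq> \<zero> \<or> w \<noteq> \<zero>"
    and e: "u \<otimes> y = v \<otimes> x" "u \<otimes> z = w \<otimes> x" "v \<otimes> z = w \<otimes> y"
  shows "\<exists>t\<in>carrier R. x = t \<otimes> u \<and> y = t \<otimes> v \<and> z = t \<otimes> w"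
proof -
  have *: "inv k \<in> carrier R" "b = (inv k \<otimes> a) \<otimes> m"
    if "k \<noteq> \<zero>" "k \<in> carrier R" "a \<in> carrier R" "b \<in> carrier R" "m \<in> carrier R" "k \<otimes> b = m \<otimes> a" for k a b m
  proof -
    have k: "inv k \<in> carrier R" "inv k \<otimes> k = \<one>" using that field_Units by auto
    have "b = inv k \<otimes> k \<otimes> b" using that k by simp
    also have "\<dots> = inv k \<otimes> (k \<otimes> b)" using that(2,4) k(1) by (intro m_assoc)
    also have "\<dots> = inv k \<otimes> (m \<otimes> a)" using that by simp
    also have "\<dots> = (inv k \<otimes> a) \<otimes> m" using that k by (simp add: m_ac)
    finally show "inv k \<in> carrier R" "b = (inv k \<otimes> a) \<otimes> m" using k by auto
  qed
  consider "u \<noteq> \<zero>" | "v \<noteq> \<zero>" | "w \<noteq> \<zero>" using nz by blast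
  then show ?thesis
  proof cases
    case 1
    show ?thesis
      using 1 *[of u x x u] *[of u x y v] *[of u x z w] c e by (intro bexI[of _ "inv u \<otimes> x"]) auto
  next
    case 2
    show ?thesis
      using 2 *[of v y x u] *[of v y y v] *[of v y z w] c e by (intro bexI[of _ "inv v \<otimes> y"]) auto
  next
    case 3
    show ?thesis
      using 3 *[of w z x u] *[of w z y v] *[of w z z w] c e by (intro bexI[of _ "inv w \<otimes> z"]) auto
  qed
qed

text \<open>
  Two matrices commute iff their vectors \<open>(b, c, a - d)\<close> are parallel.
\<close>

lemma m2_commute_iff:
  assumes "a \<in> carrier R" "b \<in> carrier R" "c \<in> carrier R" "d \<in> carrier R"
    "e \<in> carrier R" "f \<in> carrier R" "g \<in> carrier R" "h \<in> carrier R"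
  shows "m2 e f g h \<otimes>\<^bsub>mat_monoid 2 R\<^esub> m2 a b c d = m2 a b c d \<otimes>\<^bsub>mat_monoid 2 R\<^esub> m2 e f g h \<longleftrightarrow>
    b \<otimes> g = c \<otimes> f \<and> b \<otimes> (e \<ominus> h) = (a \<ominus> d) \<otimes> f \<and> c \<otimes> (e \<ominus> h) = (a \<ominus> d) \<otimes> g"
proof -
  have eq: "x = y \<longleftrightarrow> u = v"
    if "x \<ominus> y = u \<ominus> v" "x \<in> carrier R" "y \<in> carrier R" "u \<in> carrier R" "v \<in> carrier R" for x y u v
    using that r_right_minus_eq[of x y] r_right_minus_eq[of u v] by simp
  have "e \<otimes> a \<oplus> f \<otimes> c = a \<otimes> e \<oplus> b \<otimes> g \<longleftrightarrow> b \<otimes> g = c \<otimes> f"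
    using assms by (auto simp: m_comm)
  moreover have "g \<otimes> b \<oplus> h \<otimes> d = c \<otimes> f \<oplus> d \<otimes> h \<longleftrightarrow> b \<otimes> g = c \<otimes> f"
    using assms by (auto simp: m_comm)
  moreover have "e \<otimes> b \<oplus> f \<otimes> d = a \<otimes> f \<oplus> b \<otimes> h \<longleftrightarrow> b \<otimes> (e \<ominus> h) = (a \<ominus> d) \<otimes> f"
    by (rule eq) (use assms in \<open>simp_all, algebra\<close>)
  moreover have "g \<otimes> a \<oplus> h \<otimes> c = c \<otimes> e \<oplus> d \<otimes> g \<longleftrightarrow> (a \<ominus> d) \<otimes> g = c \<otimes> (e \<ominus> h)"
    by (rule eq) (use assms in \<open>simp_all, algebra\<close>)
  ultimately show ?thesis using assms by auto
qed

text \<open>The matrix \<open>s * I + t * A\<close> for \<open>A = m2 a b c d\<close>. For nonscalar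
  \<open>A\<close> these are all the matrices that commute with \<open>A\<close>.\<close>

definition pencil :: "'a \<Rightarrow> 'a \<Rightarrow> 'a \<Rightarrow> 'a \<Rightarrow> 'a \<Rightarrow> 'a \<Rightarrow> 'a mat" where
  "pencil a b c d s t = m2 (s \<oplus> t \<otimes> a) (t \<otimes> b) (t \<otimes> c) (s \<oplus> t \<otimes> d)"

definition pencil_det :: "'a \<Rightarrow> 'a \<Rightarrow> 'a \<Rightarrow> 'a \<Rightarrow> 'a \<Rightarrow> 'a \<Rightarrow> 'a" where
  "pencil_det a b c d s t = det2 (s \<oplus> t \<otimes> a) (t \<otimes> b) (t \<otimes> c) (s \<oplus> t \<otimes> d)"

definition nonscalar :: "'a \<Rightarrow> 'a \<Rightarrow> 'a \<Rightarrow> 'a \<Rightarrow> bool" where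
  "nonscalar a b c d \<longleftrightarrow> b \<noteq> \<zero> \<or> c \<noteq> \<zero> \<or> a \<noteq> d"

lemma pencil_commute:
  assumes "a \<in> carrier R" "b \<in> carrier R" "c \<in> carrier R" "d \<in> carrier R"
    "s \<in> carrier R" "t \<in> carrier R" "s' \<in> carrier R" "t' \<in> carrier R"
  shows "pencil a b c d s t \<otimes>\<^bsub>mat_monoid 2 R\<^esub> pencil a b c d s' t' =
    pencil a b c d s' t' \<otimes>\<^bsub>mat_monoid 2 R\<^esub> pencil a b c d s t"
proof -
  have "t' \<otimes> b \<otimes> (t \<otimes> c) = t' \<otimes> c \<otimes> (t \<otimes> b)"
    "t' \<otimes> b \<otimes> (s \<oplus> t \<otimes> a \<ominus> (s \<oplus> t \<otimes> d)) = (s' \<oplus> t' \<otimes> a \<ominus> (s' \<oplus> t' \<otimes> d)) \<otimes> (t \<otimes> b)"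
    "t' \<otimes> c \<otimes> (s \<oplus> t \<otimes> a \<ominus> (s \<oplus> t \<otimes> d)) = (s' \<oplus> t' \<otimes> a \<ominus> (s' \<oplus> t' \<otimes> d)) \<otimes> (t \<otimes> c)"
    using assms by algebra+
  then show ?thesis unfolding pencil_def using assms by (subst m2_commute_iff) auto
qed

lemma pencil_0_1:
  assumes "a \<in> carrier R" "b \<in> carrier R" "c \<in> carrier R" "d \<in> carrier R"
  shows "pencil a b c d \<zero> \<one> = m2 a b c d"
  using assms by (simp add: pencil_def)

text \<open>Commuting makes \<open>(f, g, e - h)\<close> a multiple \<open>t\<close> of the nonzero
  vector \<open>(b, c, a - d)\<close>, and \<open>s = e - t * a\<close> accounts for the diagonal.
  The parameter \<open>t\<close> comes first so that elements can be counted for each fixed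
  \<open>t\<close>.\<close>

lemma centralizer_GL_2:
  assumes x: "m2 a b c d \<in> carrier (GL 2 R)" and ns: "nonscalar a b c d"
  shows "centralizer (GL 2 R) (m2 a b c d) =
    (\<lambda>(t, s). pencil a b c d s t) ` (SIGMA t:carrier R. {s\<in>carrier R. pencil_det a b c d s t \<noteq> \<zero>})"
    (is "?C = ?P")
proof
  have abcd: "a \<in> carrier R" "b \<in> carrier R" "c \<in> carrier R" "d \<in> carrier R"
    using x by (auto simp: m2_in_GL_iff)
  show "?C \<subseteq> ?P"
  proof
    fix y assume y: "y \<in> ?C"
    then obtain e f g h where y_eq: "y = m2 e f g h"
      and efgh: "e \<in> carrier R" "f \<in> carrier R" "g \<in> carrier R" "h \<in> carrier R"
      and det: "det2 e f g h \<noteq> \<zero>"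
      unfolding centralizer_def by (auto elim: GL_2_cases)
    have "b \<otimes> g = c \<otimes> f" "b \<otimes> (e \<ominus> h) = (a \<ominus> d) \<otimes> f" "c \<otimes> (e \<ominus> h) = (a \<ominus> d) \<otimes> g"
      using y abcd efgh m2_commute_iff[of a b c d e f g h] by (auto simp: centralizer_def y_eq)
    then obtain t where t: "t \<in> carrier R" "f = t \<otimes> b" "g = t \<otimes> c" "e \<ominus> h = t \<otimes> (a \<ominus> d)"
      using cross_product_zero_imp_multiple[of b c "a \<ominus> d" f g "e \<ominus> h"] abcd efgh ns by (auto simp: nonscalar_def)
    define s where "s = e \<ominus> t \<otimes> a"
    have s: "s \<in> carrier R" using efgh t abcd by (simp add: s_def)
    have e: "e = s \<oplus> t \<otimes> a" unfolding s_def using efgh t(1) abcd by algebra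
    have "h = e \<ominus> (e \<ominus> h)" using efgh by algebra
    also have "\<dots> = s \<oplus> t \<otimes> d" unfolding t(4) s_def using efgh t(1) abcd by algebra
    finally have "y = pencil a b c d s t" "pencil_det a b c d s t = det2 e f g h"
      using e t by (simp_all add: y_eq pencil_def pencil_det_def)
    with s t det show "y \<in> ?P" by (auto intro!: image_eqI[of _ _ "(t, s)"])
  qed
  show "?P \<subseteq> ?C"
  proof
    fix y assume "y \<in> ?P"
    then obtain s t where st: "s \<in> carrier R" "t \<in> carrier R" "pencil_det a b c d s t \<noteq> \<zero>"
      and y: "y = pencil a b c d s t" by auto
    have "y \<in> carrier (GL 2 R)"
      using st abcd by (simp add: y pencil_def pencil_det_def m2_in_GL_iff)
    then show "y \<in> ?C"
      using pencil_commute[of a b c d s t \<zero> \<one>] st abcd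
      by (simp add: y pencil_0_1 centralizer_def)
  qed
qed

lemma pencil_inj:
  assumes "a \<in> carrier R" "b \<in> carrier R" "c \<in> carrier R" "d \<in> carrier R" and ns: "nonscalar a b c d"
    and st: "s \<in> carrier R" "t \<in> carrier R" "s' \<in> carrier R" "t' \<in> carrier R"
    and eq: "pencil a b c d s t = pencil a b c d s' t'"
  shows "s = s' \<and> t = t'"
proof -
  have e: "s \<oplus> t \<otimes> a = s' \<oplus> t' \<otimes> a" "t \<otimes> b = t' \<otimes> b" "t \<otimes> c = t' \<otimes> c" "s \<oplus> t \<otimes> d = s' \<oplus> t' \<otimes> d"
    using eq by (simp_all add: pencil_def)
  have "t \<otimes> (a \<ominus> d) = (s \<oplus> t \<otimes> a) \<ominus> (s \<oplus> t \<otimes> d)" using assms by algebra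
  also have "\<dots> = t' \<otimes> (a \<ominus> d)" unfolding e using assms by algebra
  finally have "t \<otimes> (a \<ominus> d) = t' \<otimes> (a \<ominus> d)" .
  moreover have "b \<noteq> \<zero> \<or> c \<noteq> \<zero> \<or> a \<ominus> d \<noteq> \<zero>" using ns assms by (auto simp: nonscalar_def)
  ultimately have t: "t = t'" using e assms m_rcancel by (metis minus_closed)
  then show ?thesis using e(1) assms by simp
qed

text \<open>For fixed \<open>t\<close> the determinant is a monic quadratic in \<open>s\<close> with
  linear coefficient \<open>t * (a + d)\<close>, so a root determines the only other possible one by
  Vieta.\<close>

lemma pencil_det_roots:
  assumes abcd: "a \<in> carrier R" "b \<in> carrier R" "c \<in> carrier R" "d \<in> carrier R" and t: "t \<in> carrier R"
    and s: "s \<in> carrier R" "pencil_det a b c d s t = \<zero>"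
    and s': "s' \<in> carrier R" "pencil_det a b c d s' t = \<zero>"
  shows "s' = s \<or> s' = \<ominus> (s \<oplus> t \<otimes> (a \<oplus> d))"
proof -
  have "(s' \<ominus> s) \<otimes> (s' \<ominus> \<ominus> (s \<oplus> t \<otimes> (a \<oplus> d))) = pencil_det a b c d s' t \<ominus> pencil_det a b c d s t"
    unfolding pencil_det_def det2_def using abcd t s(1) s'(1) by algebra
  also have "\<dots> = \<zero>" using s s' by simp
  finally have "s' \<ominus> s = \<zero> \<or> s' \<ominus> \<ominus> (s \<oplus> t \<otimes> (a \<oplus> d)) = \<zero>"
    using abcd t s s' by (simp only: integral_iff m_closed a_closed a_inv_closed minus_closed)
  then show ?thesis using abcd t s s' by simp
qed

end

section \<open>Centralizer orders over a finite field\<close>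

locale finite_field = field +
  assumes finite_carrier [simp]: "finite (carrier R)"
begin

lemma finite_GL_2: "finite (carrier (GL 2 R))"
proof (rule finite_subset)
  show "carrier (GL 2 R) \<subseteq> (\<lambda>(a, b, c, d). m2 a b c d) `
      (carrier R \<times> carrier R \<times> carrier R \<times> carrier R)"
    by (auto elim!: GL_2_cases intro!: image_eqI[of _ _ "(_, _, _, _)"])
qed auto

sublocale GL: finite_group "GL 2 R"
  using group_GL_2 finite_GL_2 by (simp add: finite_group_def finite_group_axioms_def)

lemma center_GL_2: "GL.center = (\<lambda>s. m2 s \<zero> \<zero> s) ` (carrier R - {\<zero>})"
proof
  show "GL.center \<subseteq> (\<lambda>s. m2 s \<zero> \<zero> s) ` (carrier R - {\<zero>})"
  proof
    fix z assume z: "z \<in> GL.center"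
    then obtain a b c d where z_eq: "z = m2 a b c d"
      and abcd: "a \<in> carrier R" "b \<in> carrier R" "c \<in> carrier R" "d \<in> carrier R"
      and det: "det2 a b c d \<noteq> \<zero>"
      unfolding GL.center_def by (auto elim: GL_2_cases)
    have comm: "y \<otimes>\<^bsub>GL 2 R\<^esub> z = z \<otimes>\<^bsub>GL 2 R\<^esub> y" if "y \<in> carrier (GL 2 R)" for y
      using z that by (auto simp: GL.center_def centralizer_def)
    \<comment> \<open>Commuting with the two elementary transvections is enough to force a scalar
      matrix.\<close>
    have "m2 \<one> \<one> \<zero> \<one> \<in> carrier (GL 2 R)" "m2 \<one> \<zero> \<one> \<one> \<in> carrier (GL 2 R)"
      by (simp_all add: m2_in_GL_iff det2_def a_minus_def)
    from this[THEN comm] have "b = \<zero>" "c = \<zero>" "a = d"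
      using abcd by (auto simp: z_eq m2_commute_iff)
    then show "z \<in> (\<lambda>s. m2 s \<zero> \<zero> s) ` (carrier R - {\<zero>})"
      using abcd det by (auto simp: z_eq det2_def a_minus_def)
  qed
  show "(\<lambda>s. m2 s \<zero> \<zero> s) ` (carrier R - {\<zero>}) \<subseteq> GL.center"
  proof
    fix z assume "z \<in> (\<lambda>s. m2 s \<zero> \<zero> s) ` (carrier R - {\<zero>})"
    then obtain s where s: "s \<in> carrier R" "s \<noteq> \<zero>" and z: "z = m2 s \<zero> \<zero> s" by auto
    have "y \<otimes>\<^bsub>mat_monoid 2 R\<^esub> z = z \<otimes>\<^bsub>mat_monoid 2 R\<^esub> y" if "y \<in> carrier (GL 2 R)" for y
      using that s by (elim GL_2_cases) (simp add: z m_comm)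
    moreover have "z \<in> carrier (GL 2 R)"
      using s integral_iff[of s s] by (simp add: z m2_in_GL_iff det2_def a_minus_def)
    ultimately show "z \<in> GL.center" by (auto simp: GL.center_def centralizer_def)
  qed
qed

lemma card_center_GL_2: "card GL.center = card (carrier R) - 1"
  unfolding center_GL_2 by (subst card_image) (auto intro: inj_onI)

lemma m2_in_center_iff:
  assumes "m2 a b c d \<in> carrier (GL 2 R)"
  shows "m2 a b c d \<in> GL.center \<longleftrightarrow> \<not> nonscalar a b c d"
  using assms by (auto simp: center_GL_2 nonscalar_def m2_in_GL_iff det2_def a_minus_def)

lemma noncentral_cases:
  assumes "x \<in> carrier (GL 2 R) - GL.center"
  obtains a b c d where "x = m2 a b c d" "a \<in> carrier R" "b \<in> carrier R" "c \<in> carrier R" "d \<in> carrier R"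
    "m2 a b c d \<in> carrier (GL 2 R)" "nonscalar a b c d"
  using assms m2_in_center_iff by (auto elim!: GL_2_cases simp: m2_in_GL_iff)

text \<open>The pencil parameters are unique, so it suffices to count them; \<open>t = 0\<close>
  gives the nonzero scalar matrices.\<close>

lemma card_centralizer_GL_2:
  assumes x: "m2 a b c d \<in> carrier (GL 2 R)" and ns: "nonscalar a b c d"
  shows "card (centralizer (GL 2 R) (m2 a b c d)) = (card (carrier R) - 1) +
    (\<Sum>t\<in>carrier R - {\<zero>}. card {s\<in>carrier R. pencil_det a b c d s t \<noteq> \<zero>})"
proof -
  have abcd: "a \<in> carrier R" "b \<in> carrier R" "c \<in> carrier R" "d \<in> carrier R"
    using x by (auto simp: m2_in_GL_iff)
  have "card (centralizer (GL 2 R) (m2 a b c d)) =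
      card (SIGMA t:carrier R. {s\<in>carrier R. pencil_det a b c d s t \<noteq> \<zero>})"
    unfolding centralizer_GL_2[OF assms]
    using pencil_inj[OF abcd ns] by (intro card_image) (auto intro!: inj_onI)
  also have "\<dots> = (\<Sum>t\<in>carrier R. card {s\<in>carrier R. pencil_det a b c d s t \<noteq> \<zero>})"
    by (intro card_SigmaI) auto
  also have "\<dots> = card {s\<in>carrier R. pencil_det a b c d s \<zero> \<noteq> \<zero>} +
      (\<Sum>t\<in>carrier R - {\<zero>}. card {s\<in>carrier R. pencil_det a b c d s t \<noteq> \<zero>})"
    by (rule sum.remove) auto
  also have "{s\<in>carrier R. pencil_det a b c d s \<zero> \<noteq> \<zero>} = carrier R - {\<zero>}"
    using abcd by (auto simp: pencil_det_def det2_def a_minus_def integral_iff)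
  finally show ?thesis by simp
qed

lemma card_pencil_det_nonzero_ge:
  assumes "a \<in> carrier R" "b \<in> carrier R" "c \<in> carrier R" "d \<in> carrier R" "t \<in> carrier R"
  shows "card (carrier R) - 2 \<le> card {s\<in>carrier R. pencil_det a b c d s t \<noteq> \<zero>}"
proof -
  let ?Z = "{s\<in>carrier R. pencil_det a b c d s t = \<zero>}"
  have "card ?Z \<le> 2"
  proof (cases "?Z = {}")
    case True
    then show ?thesis by (simp only: card.empty)
  next
    case False
    then obtain s where "s \<in> ?Z" by blast
    then have "?Z \<subseteq> {s, \<ominus> (s \<oplus> t \<otimes> (a \<oplus> d))}"
      using pencil_det_roots[OF assms, of s] by auto
    then have "card ?Z \<le> card {s, \<ominus> (s \<oplus> t \<otimes> (a \<oplus> d))}" by (intro card_mono) auto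
    also have "\<dots> \<le> 2" by (simp add: card_insert_if)
    finally show ?thesis .
  qed
  moreover have "card (carrier R - ?Z) = card (carrier R) - card ?Z"
    by (intro card_Diff_subset) auto
  moreover have "carrier R - ?Z = {s\<in>carrier R. pencil_det a b c d s t \<noteq> \<zero>}" by auto
  ultimately show ?thesis by simp
qed

text \<open>A noncentral centralizer lies in a pencil and is therefore abelian, so it is contained
  in the centralizer of each of its elements. Exchanging \<open>x\<close> and \<open>y\<close> gives
  the other inclusion.\<close>

lemma noncentral_centralizer_eq:
  assumes x: "x \<in> carrier (GL 2 R) - GL.center"
    and y: "y \<in> centralizer (GL 2 R) x - GL.center"
  shows "centralizer (GL 2 R) y = centralizer (GL 2 R) x"
proof -
  have sub: "centralizer (GL 2 R) u \<subseteq> centralizer (GL 2 R) v"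
    if *: "u \<in> carrier (GL 2 R) - GL.center" and v: "v \<in> centralizer (GL 2 R) u" for u v
  proof -
    obtain a b c d where u: "u = m2 a b c d"
      and abcd: "a \<in> carrier R" "b \<in> carrier R" "c \<in> carrier R" "d \<in> carrier R"
      and "m2 a b c d \<in> carrier (GL 2 R)" "nonscalar a b c d"
      using noncentral_cases[OF *] .
    note C = centralizer_GL_2[OF this(6,7), folded u]
    have "w \<otimes>\<^bsub>mat_monoid 2 R\<^esub> v = v \<otimes>\<^bsub>mat_monoid 2 R\<^esub> w" if "w \<in> centralizer (GL 2 R) u" for w
      using that v pencil_commute[OF abcd] unfolding C by auto
    then show ?thesis using GL.centralizer_subset by (auto simp: centralizer_def)
  qed
  have y': "y \<in> carrier (GL 2 R) - GL.center" using y GL.centralizer_subset by auto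
  show ?thesis
    using sub[OF x, of y] sub[OF y', of x] GL.centralizer_sym[of x y] x y by auto
qed

lemma three_elements:
  assumes "card (carrier R) \<ge> 3"
  obtains l where "l \<in> carrier R" "l \<noteq> \<zero>" "l \<noteq> \<one>"
proof -
  have "card {\<zero>, \<one>} \<le> 2" by (simp add: card_insert_if)
  then have "\<not> carrier R \<subseteq> {\<zero>, \<one>}"
    using assms card_mono[of "{\<zero>, \<one>}" "carrier R"] by auto
  then show ?thesis using that by blast
qed

text \<open>
  The map \<open>u \<mapsto> u\<^sup>2 + u\<close> takes the same value at \<open>0\<close> and \<open>-1\<close>, hence is not onto.
\<close>

lemma irreducible_quadratic_exists:
  obtains k where "k \<in> carrier R" "k \<noteq> \<zero>" "\<And>u. u \<in> carrier R \<Longrightarrow> u \<otimes> u \<oplus> u \<noteq> k"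
proof -
  let ?h = "\<lambda>u. u \<otimes> u \<oplus> u"
  have h: "?h \<zero> = \<zero>" "?h (\<ominus> \<one>) = \<zero>" by (simp_all add: l_minus r_neg)
  have "\<not> inj_on ?h (carrier R)"
  proof
    assume inj: "inj_on ?h (carrier R)"
    have "?h (\<ominus> \<one>) = ?h \<zero>" by (simp only: h)
    from inj_onD[OF inj this] have "\<ominus> \<one> = \<zero>" by simp
    then show False by (metis minus_minus minus_zero one_closed zero_not_one)
  qed
  then have "\<not> carrier R \<subseteq> ?h ` carrier R" using finite_surj_inj[OF finite_carrier] by blast
  then obtain k where k: "k \<in> carrier R" "k \<notin> ?h ` carrier R" by blast
  have "\<zero> \<in> ?h ` carrier R" by (rule image_eqI[where x = \<zero>]) simp_all
  then have "k \<noteq> \<zero>" using k(2) by metis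
  moreover have "u \<otimes> u \<oplus> u \<noteq> k" if "u \<in> carrier R" for u
    using k(2) imageI[OF that, of ?h] by metis
  ultimately show ?thesis using that k(1) by blast
qed

text \<open>The matrix \<open>?x\<close> has characteristic polynomial \<open>X^2 + X - k\<close>,
  without roots by the choice of \<open>k\<close>, so all nonzero members of its pencil are
  invertible. Conjugating by the diagonal matrix \<open>?g\<close> rescales the off-diagonal entries
  but keeps the diagonal, hence leaves the pencil.\<close>

lemma extremal_GL_2:
  assumes "card (carrier R) \<ge> 3"
  obtains x g where "x \<in> carrier (GL 2 R) - GL.center" "g \<in> carrier (GL 2 R)"
    "g \<otimes>\<^bsub>GL 2 R\<^esub> x \<otimes>\<^bsub>GL 2 R\<^esub> inv\<^bsub>GL 2 R\<^esub> g \<notin> centralizer (GL 2 R) x"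
    "card (centralizer (GL 2 R) x) = (card (carrier R) + 1) * card GL.center"
proof -
  obtain k where k: "k \<in> carrier R" "k \<noteq> \<zero>" and irr: "\<And>u. u \<in> carrier R \<Longrightarrow> u \<otimes> u \<oplus> u \<noteq> k"
    using irreducible_quadratic_exists by blast
  obtain l where l: "l \<in> carrier R" "l \<noteq> \<zero>" "l \<noteq> \<one>" using three_elements[OF assms] .
  have il: "inv l \<in> carrier R" "inv l \<otimes> l = \<one>" using l field_Units by auto
  let ?x = "m2 \<zero> k \<one> (\<ominus> \<one>)" and ?g = "m2 l \<zero> \<zero> \<one>"
  let ?y = "m2 \<zero> (l \<otimes> k) (inv l) (\<ominus> \<one>)"
  have x: "?x \<in> carrier (GL 2 R)" using k by (simp add: m2_in_GL_iff det2_def a_minus_def)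
  have ns: "nonscalar \<zero> k \<one> (\<ominus> \<one>)" using k by (simp add: nonscalar_def)
  have g: "?g \<in> carrier (GL 2 R)" using l by (simp add: m2_in_GL_iff det2_def a_minus_def)
  have "?y \<in> carrier (GL 2 R)"
  proof -
    have "\<zero> \<otimes> \<ominus> \<one> \<ominus> l \<otimes> k \<otimes> inv l = \<ominus> (inv l \<otimes> l \<otimes> k)" using l il(1) k by algebra
    then show ?thesis using l il k by (simp add: m2_in_GL_iff det2_def)
  qed
  moreover have "?y \<otimes>\<^bsub>GL 2 R\<^esub> ?g = ?g \<otimes>\<^bsub>GL 2 R\<^esub> ?x"
    using l il k by (simp add: l_minus)
  ultimately have conj: "?g \<otimes>\<^bsub>GL 2 R\<^esub> ?x \<otimes>\<^bsub>GL 2 R\<^esub> inv\<^bsub>GL 2 R\<^esub> ?g = ?y"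
    using g x by (metis GL.inv_solve_right GL.m_closed)
  have "inv l \<noteq> \<one>" using il l by auto
  then have nc: "?y \<notin> centralizer (GL 2 R) ?x"
    using l il k by (auto simp: centralizer_def m2_commute_iff a_minus_def simp del: m2_mult)
  have V: "{s\<in>carrier R. pencil_det \<zero> k \<one> (\<ominus> \<one>) s t \<noteq> \<zero>} = carrier R"
    if t: "t \<in> carrier R" "t \<noteq> \<zero>" for t
  proof -
    have "pencil_det \<zero> k \<one> (\<ominus> \<one>) s t \<noteq> \<zero>" if s: "s \<in> carrier R" for s
    proof
      assume 0: "pencil_det \<zero> k \<one> (\<ominus> \<one>) s t = \<zero>"
      have i: "inv t \<in> carrier R" "inv t \<otimes> t = \<one>" using t field_Units by auto
      \<comment> \<open>Dividing the determinant \<open>s^2 - s * t - k * t^2\<close> by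
        \<open>t^2\<close> gives \<open>u^2 + u - k\<close> for this \<open>u\<close>.\<close>
      define u where "u = \<ominus> (inv t \<otimes> s)"
      have u: "u \<in> carrier R" using i s by (simp add: u_def)
      have "inv t \<otimes> inv t \<otimes> pencil_det \<zero> k \<one> (\<ominus> \<one>) s t =
          u \<otimes> u \<oplus> (inv t \<otimes> t) \<otimes> u \<ominus> (inv t \<otimes> t) \<otimes> (inv t \<otimes> t) \<otimes> k"
        unfolding pencil_det_def det2_def u_def using t s k i(1) by algebra
      then have "u \<otimes> u \<oplus> u \<ominus> k = \<zero>" using 0 i u k by simp
      then show False using irr[OF u] u k by simp
    qed
    then show ?thesis by auto
  qed
  have "card (centralizer (GL 2 R) ?x) =
      (card (carrier R) - 1) + (card (carrier R) - 1) * card (carrier R)"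
    unfolding card_centralizer_GL_2[OF x ns] using V by simp
  also have "\<dots> = (card (carrier R) + 1) * card GL.center"
    unfolding card_center_GL_2 by (cases "card (carrier R)") (auto simp: algebra_simps)
  finally have "card (centralizer (GL 2 R) ?x) = (card (carrier R) + 1) * card GL.center" .
  with x ns g nc conj show ?thesis using that[of ?x ?g] m2_in_center_iff[OF x] by simp
qed

text \<open>Each nonzero \<open>t\<close> admits between \<open>q - 2\<close> and \<open>q\<close>
  values of \<open>s\<close>; adding the \<open>q - 1\<close> scalars puts the centralizer order
  between \<open>(q - 1) * (q - 1)\<close> and \<open>(q + 1) * (q - 1)\<close>.\<close>

lemma ca_group_GL_2:
  assumes "card (carrier R) \<ge> 3"
  shows "ca_group (GL 2 R) (card (carrier R))"
proof
  let ?q = "card (carrier R)"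
  show "?q \<ge> 3" by (rule assms)
  show "carrier (GL 2 R) \<noteq> GL.center" using extremal_GL_2[OF assms] by blast
  fix x assume x: "x \<in> carrier (GL 2 R) - GL.center"
  then show "centralizer (GL 2 R) y = centralizer (GL 2 R) x"
    if "y \<in> centralizer (GL 2 R) x - GL.center" for y
    using noncentral_centralizer_eq that by blast
  obtain a b c d where x_eq: "x = m2 a b c d"
    and abcd: "a \<in> carrier R" "b \<in> carrier R" "c \<in> carrier R" "d \<in> carrier R"
    and "m2 a b c d \<in> carrier (GL 2 R)" "nonscalar a b c d"
    using noncentral_cases[OF x] .
  note C = card_centralizer_GL_2[OF this(6,7), folded x_eq]
  let ?V = "\<lambda>t. {s\<in>carrier R. pencil_det a b c d s t \<noteq> \<zero>}"
  have "(?q - 1) * (?q - 2) \<le> (\<Sum>t\<in>carrier R - {\<zero>}. card (?V t))"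
    using sum_mono[of "carrier R - {\<zero>}" "\<lambda>_. ?q - 2" "\<lambda>t. card (?V t)"]
      card_pencil_det_nonzero_ge[OF abcd] by simp
  moreover have "(?q - 1) + (?q - 1) * (?q - 2) = (?q - 1) * (?q - 1)"
  proof -
    obtain m where "?q = m + 2" using assms le_Suc_ex[of 2 ?q] by auto
    then show ?thesis by simp
  qed
  ultimately show "(?q - 1) * card GL.center \<le> card (centralizer (GL 2 R) x)"
    unfolding C card_center_GL_2 by linarith
  have "(\<Sum>t\<in>carrier R - {\<zero>}. card (?V t)) \<le> (?q - 1) * ?q"
    using sum_mono[of "carrier R - {\<zero>}" "\<lambda>t. card (?V t)" "\<lambda>_. ?q"]
      card_mono[of "carrier R" "?V t" for t] by simp
  moreover have "(?q + 1) * (?q - 1) = (?q - 1) + (?q - 1) * ?q"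
    by (cases ?q) (auto simp: algebra_simps)
  ultimately show "card (centralizer (GL 2 R) x) \<le> (?q + 1) * card GL.center"
    unfolding C card_center_GL_2 by linarith
qed

end

section \<open>Odd prime powers and the conclusion\<close>

lemma odd_prime_power_ge_3:
  assumes "odd_prime_power q"
  shows "q \<ge> 3"
proof -
  obtain p k where p: "prime p" "odd p" "0 < k" "q = p ^ k"
    using assms by (auto simp: odd_prime_power_def)
  have "p \<ge> 2" using p(1) by (rule prime_ge_2_nat)
  moreover have "p \<noteq> 2" using p(2) by auto
  moreover have "p \<le> p ^ k" using p(3) \<open>p \<ge> 2\<close> by (intro self_le_power) auto
  ultimately show ?thesis using p(4) by linarith
qed

text \<open>Powers of 3 suffice. Thus the filter in the cutoff definition is nontrivial, and a limit
  along it can be refuted.\<close>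

lemma odd_prime_power_unbounded: "\<exists>q\<ge>N. odd_prime_power q"
proof -
  have "(2::nat) ^ N \<le> 3 ^ N" by (intro power_mono) auto
  then have "N \<le> 3 ^ Suc N" unfolding power_Suc using less_exp[of N] by linarith
  moreover have "odd_prime_power (3 ^ Suc N)"
    unfolding odd_prime_power_def by (intro exI[of _ 3] exI[of _ "Suc N"]) auto
  ultimately show ?thesis by blast
qed

text \<open>\<open>card\<close> of an infinite set is 0, so a positive value forces
  finiteness.\<close>

lemma finite_field_of_card:
  assumes "field R" "card (carrier R) \<ge> 3"
  shows "finite_field R"
  using assms card_ge_0_finite[of "carrier R"] by (simp add: finite_field_def finite_field_axioms_def)

theorem theorem4p3:
  shows
    "(\<forall>q (R :: ('a, 'm) ring_scheme).
        odd_prime_power q \<and> field R \<and> card (carrier R) = q \<longrightarrow>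
          (real q + 1) / 4 \<le> real (commuting_tmix (GL 2 R) (1/4)) \<and>
          int (commuting_tmix (GL 2 R) (1/4)) \<le> \<lceil>(real q + 1) * ln 16 + 2\<rceil>)
     \<and>
     (\<forall>F :: nat \<Rightarrow> ('b, 'n) ring_scheme.
        (\<forall>q. odd_prime_power q \<longrightarrow> field (F q) \<and> card (carrier (F q)) = q) \<longrightarrow>
          \<not> exhibits_cutoff {q. odd_prime_power q} (\<lambda>q. commuting_tmix (GL 2 (F q))))"
proof (intro conjI allI impI)
  fix q and R :: "('a, 'm) ring_scheme"
  assume "odd_prime_power q \<and> field R \<and> card (carrier R) = q"
  then have R: "field R" "card (carrier R) = q" "q \<ge> 3" using odd_prime_power_ge_3 by auto
  interpret finite_field R using R finite_field_of_card by blast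
  interpret ca_group "GL 2 R" q using ca_group_GL_2 R by simp
  show "int (commuting_tmix (GL 2 R) (1/4)) \<le> \<lceil>(real q + 1) * ln 16 + 2\<rceil>"
    by (rule commuting_tmix_quarter_le)
  obtain x g where "x \<in> carrier (GL 2 R) - GL.center" "g \<in> carrier (GL 2 R)"
    "g \<otimes>\<^bsub>GL 2 R\<^esub> x \<otimes>\<^bsub>GL 2 R\<^esub> inv\<^bsub>GL 2 R\<^esub> g \<notin> centralizer (GL 2 R) x"
    "card (centralizer (GL 2 R) x) = (q + 1) * card GL.center"
    using extremal_GL_2 R by metis
  from commuting_tmix_ge[OF this, of "1 / 4"]
  show "(real q + 1) / 4 \<le> real (commuting_tmix (GL 2 R) (1/4))" by simp
next
  fix F :: "nat \<Rightarrow> ('b, 'n) ring_scheme"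
  assume F: "\<forall>q. odd_prime_power q \<longrightarrow> field (F q) \<and> card (carrier (F q)) = q"
  let ?r = "\<lambda>q. real (commuting_tmix (GL 2 (F q)) (1/10)) / real (commuting_tmix (GL 2 (F q)) (9/10))"
  have ratio: "\<bar>?r q - 1\<bar> \<ge> 1 / 5" if q: "odd_prime_power q" "q \<ge> 100" for q
  proof -
    have R: "field (F q)" "card (carrier (F q)) = q" "q \<ge> 3" using F q by auto
    interpret finite_field "F q" using R finite_field_of_card by metis
    interpret ca_group "GL 2 (F q)" q using ca_group_GL_2 R by simp
    obtain x g where "x \<in> carrier (GL 2 (F q)) - GL.center" "g \<in> carrier (GL 2 (F q))"
      "g \<otimes>\<^bsub>GL 2 (F q)\<^esub> x \<otimes>\<^bsub>GL 2 (F q)\<^esub> inv\<^bsub>GL 2 (F q)\<^esub> g \<notin> centralizer (GL 2 (F q)) x"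
      "card (centralizer (GL 2 (F q)) x) = (q + 1) * card GL.center"
      using extremal_GL_2 R by metis
    from commuting_tmix_ratio[OF this q(2)] show ?thesis .
  qed
  show "\<not> exhibits_cutoff {q. odd_prime_power q} (\<lambda>q. commuting_tmix (GL 2 (F q)))"
  proof
    assume "exhibits_cutoff {q. odd_prime_power q} (\<lambda>q. commuting_tmix (GL 2 (F q)))"
    then have "(?r \<longlongrightarrow> 1) (inf at_top (principal {q. odd_prime_power q}))"
      unfolding exhibits_cutoff_def by (auto dest: bspec[of _ _ "1 / 10"])
    then have "\<forall>\<^sub>F q in inf at_top (principal {q. odd_prime_power q}). dist (?r q) 1 < 1 / 5"
      by (rule tendstoD) simp
    then obtain N where N: "\<And>q. q \<ge> N \<Longrightarrow> odd_prime_power q \<Longrightarrow> dist (?r q) 1 < 1 / 5"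
      by (auto simp: eventually_inf_principal eventually_at_top_linorder)
    \<comment> \<open>Past both thresholds an odd prime power still exists, where the ratio would be
      both within \<open>1 / 5\<close> of 1 and at least that far from it.\<close>
    obtain q where "q \<ge> max N 100" "odd_prime_power q" using odd_prime_power_unbounded by blast
    with N[of q] ratio[of q] show False by (simp add: dist_real_def)
  qed
qed

end
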